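(* Let $P=P(A,a,b,b_a)$ be a lattice-free $\Delta$-modular pyramid in $\mathbb{R}^n$. Suppose that at least one of the following is satisfied: (1) $\Delta(A)$ is prime; (2) all $n\times n$ minors of $A$ are in $\{0,\pm\frac{\Delta(A)}{2},\pm\Delta(A)\}$. Then $w^{a}(P)\le\Delta-2$.
   Context: For an integer matrix $M$ with $n$ columns and at least $n$ rows, $\Delta(M)$ is the maximum absolute value of an $n\times n$ minor of $M$. For $A\in\mathbb{Z}^{m\times n}$ with $m\ge n$ and full column rank, $C(A):=\{x\in\mathbb{R}^n: Ax\ge 0\}$, with dual cone $C(A)^*=\{x\in\mathbb{R}^n: y^Tx\ge 0\ \forall y\in C(A)\}$. Pyramid: let $A\in\mathbb{Z}^{m\times n}$ have full column rank with $m\ge n$, let $b\in\mathbb{Z}^m$, let $v$ satisfy $Av=b$, let $a\in\mathbb{Z}^n$ with $-a\in\operatorname{int}(C(A)^* )$, and let $b_a$ be an integer with $b_a>a^Tv$. The pyramid is $P(A,a,b,b_a)=\{x\in\mathbb{R}^n: Ax\le b,\ a^Tx\le b_a\}$. It is $\Delta$-modular if $\Delta=\Delta\begin{pmatrix}A\\ a^T\end{pmatrix}$, the maximum absolute value of an $n\times n$ minor of the $(m+1)\times n$ matrix (whereas $\Delta(A)$ refers to $A$ alone). It is lattice-free if it contains no point of $\mathbb{Z}^n$. The width in direction $a$ is $w^a(P)=\max_{x\in P}a^Tx-\min_{y\in P}a^Ty$.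
   Formalization: The pyramid P is additionally assumed to be full-dimensional (nonempty interior); without this the claim fails, e.g. for A with rows (2,0),(-2,0),(0,-1), b=(1,-1,0), a=(0,1), where P={1/2}×[0,b_a] is lattice-free, Δ=2 and the width is b_a. *)

theory Defs
  imports "HOL-Analysis.Analysis" "HOL-Computational_Algebra.Primes"
begin

definition int_vec :: "int ^ 'n \<Rightarrow> real ^ 'n" where
  "int_vec a = (\<chi> i. real_of_int (a $ i))"

definition int_mat :: "int ^ 'n ^ 'm \<Rightarrow> real ^ 'n ^ 'm" where
  "int_mat A = map_matrix real_of_int A"

text \<open>
  A maximal minor is obtained by choosing \<open>CARD('n)\<close> distinct rows.  The index types carry no
  order, so every enumeration of the chosen rows is admitted; the set therefore contains each
  maximal minor up to sign.
\<close>

definition max_minors :: "int ^ 'n ^ 'm \<Rightarrow> int set" where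
  "max_minors M = {det (\<chi> i. M $ f i) | f :: 'n \<Rightarrow> 'm. inj f}"

text \<open>Meaningful only for matrices with at least as many rows as columns (otherwise \<open>Max {}\<close>).\<close>

definition Delta :: "int ^ 'n ^ 'm \<Rightarrow> int" where
  "Delta M = Max (abs ` max_minors M)"

text \<open>The row \<open>a\<close> put below \<open>A\<close>; the new row has index \<open>None\<close>.\<close>

definition append_row :: "int ^ 'n ^ 'm \<Rightarrow> int ^ 'n \<Rightarrow> int ^ 'n ^ ('m option)" where
  "append_row A a = (\<chi> i. case i of None \<Rightarrow> a | Some j \<Rightarrow> A $ j)"

text \<open>The order on vectors is componentwise.\<close>

definition cone_of :: "int ^ 'n ^ 'm \<Rightarrow> (real ^ 'n) set" where
  "cone_of A = {x. 0 \<le> int_mat A *v x}"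

definition dual_cone :: "(real ^ 'n) set \<Rightarrow> (real ^ 'n) set" where
  "dual_cone K = {x. \<forall>y\<in>K. 0 \<le> y \<bullet> x}"

definition pyramid :: "int ^ 'n ^ 'm \<Rightarrow> int ^ 'n \<Rightarrow> int ^ 'm \<Rightarrow> int \<Rightarrow> (real ^ 'n) set" where
  "pyramid A a b b\<^sub>a =
     {x. int_mat A *v x \<le> int_vec b \<and> int_vec a \<bullet> x \<le> real_of_int b\<^sub>a}"

text \<open>The conditions on \<open>(A, a, b, b\<^sub>a)\<close> under which \<open>pyramid A a b b\<^sub>a\<close> is called a pyramid.
  They do not force it to be full-dimensional: for \<open>A\<close> with rows \<open>(2,0), (-2,0), (0,-1)\<close>,
  \<open>b = (1,-1,0)\<close>, \<open>a = (0,1)\<close> and \<open>b\<^sub>a > 0\<close> one gets the lattice-free segment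
  \<open>{1/2} \<times> [0, b\<^sub>a]\<close>, with \<open>\<Delta> = \<Delta>(A) = 2\<close> and unbounded width as \<open>b\<^sub>a\<close> grows.  Full
  dimension is therefore a separate hypothesis where it is needed.\<close>

definition pyramid_data :: "int ^ 'n ^ 'm \<Rightarrow> int ^ 'n \<Rightarrow> int ^ 'm \<Rightarrow> int \<Rightarrow> bool" where
  "pyramid_data A a b b\<^sub>a \<longleftrightarrow>
     CARD('n) \<le> CARD('m) \<and>
     rank (int_mat A) = CARD('n) \<and>
     - int_vec a \<in> interior (dual_cone (cone_of A)) \<and>
     (\<exists>v. int_mat A *v v = int_vec b \<and> int_vec a \<bullet> v < real_of_int b\<^sub>a)"

definition modular_pyramid :: "int \<Rightarrow> int ^ 'n ^ 'm \<Rightarrow> int ^ 'n \<Rightarrow> bool" where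
  "modular_pyramid \<Delta> A a \<longleftrightarrow> \<Delta> = Delta (append_row A a)"

definition lattice_free :: "(real ^ 'n) set \<Rightarrow> bool" where
  "lattice_free P \<longleftrightarrow> \<not> (\<exists>z :: int ^ 'n. int_vec z \<in> P)"

text \<open>For nonempty compact \<open>P\<close> (such as a pyramid) the supremum and infimum are attained.\<close>

definition width :: "real ^ 'n \<Rightarrow> (real ^ 'n) set \<Rightarrow> real" where
  "width a P = (SUP x\<in>P. a \<bullet> x) - (INF y\<in>P. a \<bullet> y)"

end

theory Submission
  imports Defs
begin

text \<open>Since \<open>-a\<close> is nonnegative on the cone \<open>C(A)\<close>, the functional \<open>a\<close> attains its minimum on the pyramid
at the apex \<open>v\<close>, and the width is at most \<open>b\<^sub>a - a \<bullet> v\<close>. An integral point \<open>z\<close> of \<open>v - C(A)\<close>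
satisfies all inequalities of the pyramid but possibly the last, so lattice-freeness gives
\<open>b\<^sub>a + 1 \<le> a \<bullet> z\<close>. It remains to find such a \<open>z\<close> with \<open>a \<bullet> z \<le> a \<bullet> v + \<Delta> - 1\<close>.

Take \<open>z\<close> with least total slack. Then \<open>y = v - z\<close> is a point of \<open>C(A)\<close> on which all rows of \<open>A\<close>
are integral, and no nonzero integral \<open>x\<close> satisfies \<open>0 \<le> A x \<le> A y\<close>. To bound \<open>- a \<bullet> y\<close>, let \<open>L\<close> be
the lattice of points on which all rows of \<open>A\<close> are integral; it contains the integral points. If
\<open>\<Delta>(A)\<close> is a prime \<open>p\<close> and some minor is neither \<open>0\<close> nor \<open>\<plusminus>p\<close>, then two minors are coprime, which
forces \<open>v \<in> L\<close> to be integral, contrary to lattice-freeness. So in both cases of the hypothesis all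
minors lie in \<open>{0, \<plusminus>g, \<plusminus>2 g}\<close>, where \<open>g\<close> is the least nonzero absolute value of a minor. Then \<open>L\<close>
has index \<open>g\<close> over the integral points, and in coordinates of \<open>L\<close> all minors are at most two.

Decompose \<open>y\<close> into irreducible elements of \<open>C(A) \<inter> L\<close>. Fewer than \<open>g\<close> of them occur, since among
\<open>g\<close> elements of a group of order \<open>g\<close> some consecutive ones add up to zero, here to a nonzero integral
point below \<open>y\<close> (\<open>integral_segment_sum\<close>). And \<open>-a\<close> is at most \<open>\<Delta> / g\<close> on each
(\<open>irreducible_bound\<close>): in a cone with minors at most two, an irreducible element is a normalised
extreme ray, half of one, or the sum of two halves, and the values of \<open>-a\<close> on normalised extreme
rays are, up to sign, the minors involving the row \<open>a\<close>, divided by \<open>g\<close> because of the change of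
coordinates. Altogether \<open>- a \<bullet> y \<le> (g - 1) \<Delta> / g \<le> \<Delta> - 1\<close>, as
\<open>g \<le> \<Delta>\<close>.\<close>

section \<open>Integral points and determinants with a replaced row\<close>

definition integral_points :: "(real ^ 'n) set" where
  "integral_points = {x. \<forall>i. x $ i \<in> \<int>}"

definition replace_row :: "real ^ 'n ^ 'n \<Rightarrow> 'n \<Rightarrow> real ^ 'n \<Rightarrow> real ^ 'n ^ 'n" where
  "replace_row B j d = (\<chi> i. if i = j then d else B $ i)"

definition half_space_cone :: "(real ^ 'n) set \<Rightarrow> (real ^ 'n) set" where
  "half_space_cone D = {x. \<forall>d\<in>D. 0 \<le> d \<bullet> x}"

definition pointed_rows :: "(real ^ 'n) set \<Rightarrow> bool" where
  "pointed_rows D \<longleftrightarrow> (\<forall>x. (\<forall>d\<in>D. d \<bullet> x = 0) \<longrightarrow> x = 0)"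

lemma integral_points_0 [simp]: "0 \<in> integral_points"
  by (simp add: integral_points_def)

lemma integral_points_add: "x \<in> integral_points \<Longrightarrow> y \<in> integral_points \<Longrightarrow> x + y \<in> integral_points"
  by (simp add: integral_points_def)

lemma integral_points_diff: "x \<in> integral_points \<Longrightarrow> y \<in> integral_points \<Longrightarrow> x - y \<in> integral_points"
  by (simp add: integral_points_def)

lemma integral_points_uminus: "x \<in> integral_points \<Longrightarrow> - x \<in> integral_points"
  by (simp add: integral_points_def)

lemma integral_points_scaleR: "c \<in> \<int> \<Longrightarrow> x \<in> integral_points \<Longrightarrow> c *\<^sub>R x \<in> integral_points"
  by (simp add: integral_points_def)

lemma inner_integral_points: "x \<in> integral_points \<Longrightarrow> y \<in> integral_points \<Longrightarrow> x \<bullet> y \<in> \<int>"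
  by (auto simp: integral_points_def inner_vec_def intro!: Ints_sum Ints_mult)

lemma det_in_Ints:
  fixes B :: "real ^ 'n ^ 'n"
  assumes "\<And>i j. B $ i $ j \<in> \<int>"
  shows "det B \<in> \<int>"
  unfolding det_def using assms by (auto intro!: Ints_sum Ints_mult Ints_prod)

text \<open>Cramer's rule: each coordinate of \<open>x\<close>, multiplied by \<open>det B\<close>, is an integral determinant.\<close>

lemma det_scale_integral:
  fixes B :: "real ^ 'n ^ 'n"
  assumes B: "\<And>i. B $ i \<in> integral_points" and x: "\<And>i. B $ i \<bullet> x \<in> \<int>"
  shows "det B *\<^sub>R x \<in> integral_points"
proof -
  have "x $ k * det B \<in> \<int>" for k
  proof -
    have "det (\<chi> i j. if j = k then (B *v x) $ i else B $ i $ j) \<in> \<int>"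
      using B x by (intro det_in_Ints)
        (auto simp: integral_points_def matrix_vector_mul_component)
    then show ?thesis by (simp only: cramer_lemma)
  qed
  then show ?thesis by (simp add: integral_points_def mult.commute)
qed

lemma det_eq_0_if_orthogonal:
  fixes B :: "real ^ 'n ^ 'n"
  assumes "\<And>i. B $ i \<bullet> u = 0" "u \<noteq> 0"
  shows "det B = 0"
proof -
  have "B *v u = 0" using assms(1) by (simp add: vec_eq_iff matrix_vector_mul_component)
  then show ?thesis
    using assms(2) matrix_left_invertible_ker[of B] invertible_det_nz[of B]
    by (metis invertible_def)
qed

lemma det_nonzero_orthogonal:
  fixes B :: "real ^ 'n ^ 'n"
  assumes "det B \<noteq> 0" "\<And>i. B $ i \<bullet> u = 0"
  shows "u = 0"
  using assms det_eq_0_if_orthogonal by blast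

lemma det_nonzero_if_orthogonal:
  fixes B :: "real ^ 'n ^ 'n"
  assumes "\<And>u. (\<And>i. B $ i \<bullet> u = 0) \<Longrightarrow> u = 0"
  shows "det B \<noteq> 0"
proof -
  have "\<forall>x. B *v x = 0 \<longrightarrow> x = 0"
    using assms by (simp add: vec_eq_iff matrix_vector_mul_component)
  then obtain C where "C ** B = mat 1" using matrix_left_invertible_ker[of B] by blast
  then show ?thesis by (metis det_I det_mul mult_zero_right zero_neq_one)
qed

lemma replace_row_same: "replace_row B j (B $ j) = B"
  by (simp add: replace_row_def vec_eq_iff)

lemma replace_row_rows: "(\<And>i. B $ i \<in> D) \<Longrightarrow> d \<in> D \<Longrightarrow> replace_row B j d $ i \<in> D"
  by (simp add: replace_row_def)

text \<open>Each coordinate of a vector \<open>d\<close> in the basis of rows of \<open>B\<close> is the inner product of \<open>d\<close> with a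
column \<open>u\<close> of the inverse of \<open>B\<close>. So a bound on the maximal minors of a matrix is a bound on its
rows, and on the functional \<open>c\<close>, evaluated at normalised extreme rays.\<close>

lemma det_replace_row:
  fixes B :: "real ^ 'n ^ 'n"
  assumes u: "\<And>i. B $ i \<bullet> u = (if i = j then 1 else 0)"
  shows "det (replace_row B j d) = (d \<bullet> u) * det B"
proof -
  let ?t = "d \<bullet> u"
  have d: "(d - ?t *\<^sub>R B $ j) + ?t *s B $ j = d" by (simp add: scalar_mult_eq_scaleR)
  have "u \<noteq> 0" using u[of j] by auto
  (* subtracting the multiple of row j leaves a row orthogonal to u, as all the other rows are *)
  then have z: "det (replace_row B j (d - ?t *\<^sub>R B $ j)) = 0"
    by (intro det_eq_0_if_orthogonal[of _ u]) (auto simp: replace_row_def u inner_diff_left)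
  have "det (replace_row B j ((d - ?t *\<^sub>R B $ j) + ?t *s B $ j)) =
      det (replace_row B j (d - ?t *\<^sub>R B $ j)) + det (replace_row B j (?t *s B $ j))"
    unfolding replace_row_def by (rule det_row_add)
  also have "det (replace_row B j (?t *s B $ j)) = ?t * det (replace_row B j (B $ j))"
    unfolding replace_row_def by (rule det_row_mul)
  finally show ?thesis by (simp only: z d replace_row_same add_0)
qed

lemma abs_det_row_signs:
  fixes B B' :: "real ^ 'n ^ 'n"
  assumes "\<And>i. B $ i = B' $ i \<or> B $ i = - B' $ i"
  shows "\<bar>det B\<bar> = \<bar>det B'\<bar>"
proof -
  define s :: "'n \<Rightarrow> real" where "s i = (if B $ i = B' $ i then 1 else - 1)" for i
  have "B = (\<chi> i. s i *s B' $ i)"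
    using assms by (subst vec_eq_iff) (simp add: s_def scalar_mult_eq_scaleR, metis)
  then have "det B = prod s UNIV * det (\<chi> i. B' $ i)" using det_rows_mul[of s "\<lambda>i. B' $ i"] by (rule trans[OF arg_cong[of _ _ det]])
  moreover have "\<bar>prod s UNIV\<bar> = 1"
    unfolding abs_prod by (rule prod.neutral) (simp add: s_def)
  ultimately show ?thesis by (simp add: abs_mult)
qed

section \<open>Extreme rays\<close>

text \<open>A nonzero point of the face of \<open>y\<close> at which as many rows as possible vanish spans an extreme ray:
were the rows vanishing there also to vanish on a vector off the line, moving along that vector
until a further half-space becomes tight would increase their number. The vanishing rows then have
corank one, and together with one row positive on the ray they contain a basis \<open>B\<close>. The generator
is scaled to be column \<open>j\<close> of the inverse of \<open>B\<close>, as \<open>det_replace_row\<close> requires.\<close>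

lemma extreme_ray_in_face:
  fixes D :: "(real ^ 'n) set"
  assumes fin: "finite D" and pd: "pointed_rows D"
    and y: "y \<in> half_space_cone D" "y \<noteq> 0"
  obtains u B j where "u \<in> half_space_cone D" "\<And>d. d \<in> D \<Longrightarrow> d \<bullet> y = 0 \<Longrightarrow> d \<bullet> u = 0"
    "\<And>i. B $ i \<in> D" "\<And>i. B $ i \<bullet> u = (if i = j then 1 else 0)" "det B \<noteq> 0"
proof -
  define Z where "Z u = {d \<in> D. d \<bullet> u = 0}" for u
  define F where "F = {u \<in> half_space_cone D. u \<noteq> 0 \<and> Z y \<subseteq> Z u}"
  have "y \<in> F" using y by (simp add: F_def)
  moreover have "card (Z u) < Suc (card D)" for u
    unfolding less_Suc_eq_le using fin by (auto simp: Z_def intro: card_mono)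
  ultimately obtain u where uF: "u \<in> F" and umax: "\<And>x. x \<in> F \<Longrightarrow> card (Z x) \<le> card (Z u)"
    using ex_has_greatest_nat[of "\<lambda>u. u \<in> F" y "\<lambda>u. card (Z u)" "Suc (card D)"]
    by blast
  have uC: "0 \<le> d \<bullet> u" if "d \<in> D" for d using uF that by (auto simp: F_def half_space_cone_def)
  have u0: "u \<noteq> 0" using uF by (simp add: F_def)
  have no_neg: False
    if x: "\<And>d. d \<in> Z u \<Longrightarrow> d \<bullet> x = 0" "\<And>s. x \<noteq> s *\<^sub>R u" and neg: "d1 \<in> D" "d1 \<bullet> x < 0" for x d1
  proof -
    define N where "N = {d \<in> D. d \<bullet> x < 0}"
    define q where "q d = (d \<bullet> u) / (- (d \<bullet> x))" for d
    have N: "finite N" "N \<noteq> {}" using fin neg by (auto simp: N_def)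
    define t where "t = Min (q ` N)"
    have "t \<in> q ` N" unfolding t_def using N by (intro Min_in) auto
    then obtain d0 where d0: "d0 \<in> N" "t = q d0" by blast
    have t0: "0 \<le> t" using d0 uC by (auto simp: q_def N_def intro!: divide_nonneg_neg)
    have in_cone: "0 \<le> d \<bullet> (u + t *\<^sub>R x)" if "d \<in> D" for d
    proof (cases "d \<in> N")
      case True
      then have "t \<le> q d" unfolding t_def using N by (intro Min_le) auto
      moreover have "d \<bullet> x < 0" using True by (simp add: N_def)
      ultimately have "t * (- (d \<bullet> x)) \<le> d \<bullet> u" unfolding q_def by (simp only: pos_le_divide_eq neg_0_less_iff_less)
      then show ?thesis by (simp add: inner_add_right)
    next
      case False
      then have "0 \<le> d \<bullet> x" using that by (simp add: N_def)
      then show ?thesis using uC[OF that] t0 by (simp add: inner_add_right)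
    qed
    have nz: "u + t *\<^sub>R x \<noteq> 0"
    proof
      assume z: "u + t *\<^sub>R x = 0"
      then have "t \<noteq> 0" using u0 by auto
      have "t *\<^sub>R x = - u" using z by (simp add: add_eq_0_iff)
      then have "x = (- (1 / t)) *\<^sub>R u"
        using \<open>t \<noteq> 0\<close> by (metis divideR_right inverse_eq_divide scaleR_minus_left scaleR_minus_right)
      then show False using x(2) by blast
    qed
    have sub: "Z u \<subseteq> Z (u + t *\<^sub>R x)"
      using x(1) by (auto simp: Z_def inner_add_right)
    have "u + t *\<^sub>R x \<in> F"
      using in_cone nz sub uF by (auto simp: F_def half_space_cone_def)
    then have "card (Z (u + t *\<^sub>R x)) \<le> card (Z u)" by (rule umax)
    moreover have "finite (Z (u + t *\<^sub>R x))" using fin by (simp add: Z_def)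
    ultimately have "Z (u + t *\<^sub>R x) = Z u" using sub by (metis card_seteq)
    moreover have "d0 \<in> Z (u + t *\<^sub>R x)"
      using d0 by (auto simp: Z_def N_def q_def inner_add_right inner_diff_right)
    ultimately have "d0 \<bullet> x = 0" using x(1) by auto
    then show False using d0 by (simp add: N_def)
  qed
  have line: "\<exists>s. x = s *\<^sub>R u" if x: "\<And>d. d \<in> Z u \<Longrightarrow> d \<bullet> x = 0" for x
  proof (rule ccontr)
    assume n: "\<nexists>s. x = s *\<^sub>R u"
    have "x \<noteq> 0" using n by (metis scaleR_zero_left)
    then obtain d1 where d1: "d1 \<in> D" "d1 \<bullet> x \<noteq> 0" using pd unfolding pointed_rows_def by blast
    have n': "- x \<noteq> s *\<^sub>R u" for s using n by (metis minus_minus scaleR_minus_left)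
    show False
    proof (cases "d1 \<bullet> x < 0")
      case True
      then show False using no_neg[of x d1] x n d1 by blast
    next
      case False
      then have "d1 \<bullet> (- x) < 0" using d1 by simp
      then show False using no_neg[of "- x" d1] x n' d1 by auto
    qed
  qed
  obtain d1 where d1: "d1 \<in> D" "d1 \<bullet> u \<noteq> 0" using pd u0 unfolding pointed_rows_def by blast
  then have d1pos: "d1 \<bullet> u > 0" using uC by (simp add: order_less_le)
  have "d1 \<noteq> 0" using d1 by auto
  then have ind1: "independent {d1}" by simp
  obtain S where S: "{d1} \<subseteq> S" "S \<subseteq> insert d1 (Z u)" "independent S" "insert d1 (Z u) \<subseteq> span S"
    using maximal_independent_subset_extend[OF _ ind1, of "insert d1 (Z u)"] by blast
  have orth: "x = 0" if "\<And>d. d \<in> S \<Longrightarrow> d \<bullet> x = 0" for x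
  proof -
    have sp: "d \<bullet> x = 0" if "d \<in> span S" for d
      using that \<open>\<And>d. d \<in> S \<Longrightarrow> d \<bullet> x = 0\<close>
      by (induction rule: span_induct_alt) (auto simp: inner_add_left)
    then obtain s where s: "x = s *\<^sub>R u" using line S(4) by blast
    have "d1 \<bullet> x = 0" using sp S(4) by blast
    then show ?thesis using s d1 by auto
  qed
  have "span S = UNIV"
  proof (rule ccontr)
    assume "span S \<noteq> UNIV"
    then obtain a where "a \<noteq> 0" "\<forall>x\<in>span S. a \<bullet> x = 0" using span_not_UNIV_orthogonal by blast
    then show False using orth[of a] by (metis inner_commute span_base)
  qed
  then have cardS: "card S = CARD('n)"
    using basis_card_eq_dim[of S UNIV] S(3) by simp
  have finS: "finite S" using S(3) by (rule finiteI_independent)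
  obtain g where g: "bij_betw g (UNIV :: 'n set) S"
    using finite_same_card_bij[of "UNIV :: 'n set" S] finS cardS by auto
  obtain j where j: "g j = d1" using g S(1) by (metis bij_betw_imp_surj_on imageE insert_subset)
  define B :: "real ^ 'n ^ 'n" where "B = (\<chi> i. g i)"
  define w where "w = (1 / (d1 \<bullet> u)) *\<^sub>R u"
  show ?thesis
  proof
    show "w \<in> half_space_cone D" using uC d1pos by (auto simp: half_space_cone_def w_def)
    show "d \<bullet> w = 0" if "d \<in> D" "d \<bullet> y = 0" for d
      using uF that by (auto simp: F_def Z_def w_def)
    show "B $ i \<in> D" for i
    proof -
      have "g i \<in> S" using g by (auto simp: bij_betw_def)
      then show ?thesis using S(2) d1 by (auto simp: B_def Z_def)
    qed
    show "B $ i \<bullet> w = (if i = j then 1 else 0)" for i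
    proof (cases "i = j")
      case True
      then show ?thesis using j d1 by (simp add: B_def w_def)
    next
      case False
      then have "g i \<noteq> d1" "g i \<in> S" using g j by (auto simp: bij_betw_def inj_on_def)
      then have "g i \<in> Z u" using S(2) by blast
      then show ?thesis using False by (simp add: B_def w_def Z_def)
    qed
    show "det B \<noteq> 0"
    proof (rule det_nonzero_if_orthogonal)
      fix x assume "\<And>i. B $ i \<bullet> x = 0"
      then have "d \<bullet> x = 0" if "d \<in> S" for d
        using that g by (auto simp: B_def bij_betw_def)
      then show "x = 0" by (rule orth)
    qed
  qed
qed

section \<open>The index of a sublattice and subsums in it\<close>

lemma exists_prime_order_point:
  fixes z :: "real ^ 'n"
  assumes z: "z \<notin> integral_points" and m: "real m *\<^sub>R z \<in> integral_points" "m > 0"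
  obtains p c where "prime (p :: nat)" "real c *\<^sub>R z \<notin> integral_points"
    "real p *\<^sub>R real c *\<^sub>R z \<in> integral_points"
proof -
  define q where "q = (LEAST q. q > 0 \<and> real q *\<^sub>R z \<in> integral_points)"
  have q: "q > 0" "real q *\<^sub>R z \<in> integral_points"
    using LeastI[of "\<lambda>q. q > 0 \<and> real q *\<^sub>R z \<in> integral_points" m] m by (auto simp: q_def)
  have qmin: "real r *\<^sub>R z \<notin> integral_points" if "r > 0" "r < q" for r
    using not_less_Least[of r "\<lambda>q. q > 0 \<and> real q *\<^sub>R z \<in> integral_points"] that by (auto simp: q_def)
  have "q \<noteq> 1" using q z by auto
  then obtain p where p: "prime p" "p dvd q" using prime_factor_nat by blast
  then obtain c where c: "q = p * c" by (auto elim: dvdE)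
  have "c > 0" "c < q" using c q(1) p(1) prime_gt_1_nat[OF p(1)] by auto
  with p(1) c q(2) qmin show ?thesis by (intro that[of p c]) auto
qed

text \<open>The points \<open>x\<close> for which \<open>B *v x\<close> is integral form a lattice that contains the integral points
with index \<open>\<bar>det B\<bar>\<close>; only the upper bound on the index is proved. If the lattice is larger than
that of the integral points, it has a point of prime order \<open>p\<close> modulo them, and a multiple of that
point, changed by an integral point, is some \<open>w\<close> with a coordinate \<open>w $ j = 1 / p\<close>. Exchanging
the \<open>j\<close>-th unit vector for \<open>w\<close> gives a basis \<open>E\<close> of the lattice generated by \<open>w\<close> and the integral
points; that lattice has index \<open>p\<close> over the integral points, and in its coordinates \<open>B\<close> becomes
\<open>B ** E\<close>, whose determinant is smaller by the factor \<open>p\<close>. Induction on the determinant finishes.\<close>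

lemma card_noncongruent_le_det:
  fixes B :: "real ^ 'n ^ 'n"
  assumes "\<And>i. B $ i \<in> integral_points" and "det B \<noteq> 0"
    and "finite X" and "\<And>x i. x \<in> X \<Longrightarrow> B $ i \<bullet> x \<in> \<int>"
    and "\<And>x y. x \<in> X \<Longrightarrow> y \<in> X \<Longrightarrow> x - y \<in> integral_points \<Longrightarrow> x = y"
  shows "real (card X) \<le> \<bar>det B\<bar>"
proof -
  have nat_det: "\<exists>n. \<bar>det B\<bar> = real n" if "\<And>i. B $ i \<in> integral_points" for B :: "real ^ 'n ^ 'n"
  proof -
    have "det B \<in> \<int>" using that by (intro det_in_Ints) (simp add: integral_points_def)
    then obtain k where "det B = of_int k" by (auto elim: Ints_cases)
    then have "\<bar>det B\<bar> = real (nat \<bar>k\<bar>)" by simp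
    then show ?thesis by blast
  qed
  from nat_det[OF assms(1)] obtain n where "\<bar>det B\<bar> = real n" by blast
  then show ?thesis using assms
  proof (induction n arbitrary: B X rule: less_induct)
    case (less n B X)
    have n: "n > 0" using less.prems(1,3) by auto
    show ?case
    proof (cases "\<exists>x\<in>X. \<exists>y\<in>X. x \<noteq> y")
      case False
      then have "card X \<le> 1" using less.prems(4) by (auto simp: card_le_Suc0_iff_eq)
      then show ?thesis using n less.prems(1) by simp
    next
      case True
      then obtain x1 x2 where x12: "x1 \<in> X" "x2 \<in> X" "x1 \<noteq> x2" by blast
      define z where "z = x1 - x2"
      have z: "z \<notin> integral_points" using x12 less.prems(6) by (auto simp: z_def)
      have Bz: "B $ i \<bullet> z \<in> \<int>" for i
        using less.prems(5) x12 by (simp add: z_def inner_diff_right)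
      have "det B *\<^sub>R z \<in> integral_points"
        using less.prems(2) Bz by (rule det_scale_integral)
      moreover have "real n *\<^sub>R z = det B *\<^sub>R z \<or> real n *\<^sub>R z = - (det B *\<^sub>R z)"
        using less.prems(1) by (metis abs_if scaleR_minus_left)
      ultimately have "real n *\<^sub>R z \<in> integral_points"
        using integral_points_uminus by metis
      then obtain p c where p: "prime (p :: nat)" and c: "real c *\<^sub>R z \<notin> integral_points"
        "real p *\<^sub>R real c *\<^sub>R z \<in> integral_points"
        using exists_prime_order_point[OF z _ n] by blast
      define x where "x = real c *\<^sub>R z"
      have p0: "p > 0" using p by (simp add: prime_gt_0_nat)
      have Bx: "B $ i \<bullet> x \<in> \<int>" for i using Bz by (simp add: x_def)
      obtain j where j: "x $ j \<notin> \<int>" using c(1) by (auto simp: x_def integral_points_def)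
      have "real p * x $ j \<in> \<int>" using c(2) by (simp add: x_def integral_points_def mult.assoc)
      then obtain k where k: "real p * x $ j = of_int k" by (auto elim: Ints_cases)
      have "\<not> int p dvd k"
      proof
        assume "int p dvd k"
        then obtain l where "k = int p * l" by (auto elim: dvdE)
        then have "x $ j = of_int l" using k p0 by simp
        then show False using j by simp
      qed
      then have "coprime (int p) k" using p by (simp add: prime_imp_coprime)
      then obtain e f where ef: "e * int p + f * k = 1"
        using bezout_int[of "int p" k] by (metis coprime_imp_gcd_eq_1)
      define w where "w = of_int f *\<^sub>R x + of_int e *\<^sub>R axis j (1::real)"
      have ax: "axis i (1::real) \<in> integral_points" for i :: 'n
        by (simp add: integral_points_def axis_def)
      have "real p * w $ j = of_int f * (real p * x $ j) + of_int e * real p"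
        by (simp add: w_def algebra_simps)
      also have "\<dots> = of_int (e * int p + f * k)" by (simp add: k)
      finally have wj: "real p * w $ j = 1" by (simp add: ef)
      have Bw: "B $ i \<bullet> w \<in> \<int>" for i
        using Bx[of i] inner_integral_points[OF less.prems(2) ax, of i j] by (simp add: w_def inner_add_right)
      have "real p *\<^sub>R w = of_int f *\<^sub>R (real p *\<^sub>R x) + of_int e *\<^sub>R (real p *\<^sub>R axis j (1::real))"
        by (simp add: w_def algebra_simps)
      then have pw: "real p *\<^sub>R w \<in> integral_points"
        using integral_points_add[OF integral_points_scaleR[OF Ints_of_int c(2)[folded x_def], of f]
          integral_points_scaleR[OF Ints_of_int integral_points_scaleR[OF Ints_of_nat ax[of j], of p], of e]]
        by simp
      define r where "r = w - axis j (1::real)"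
      define E :: "real ^ 'n ^ 'n" where "E = (\<chi> i l. if l = j then w $ i else mat 1 $ i $ l)"
      have detE: "det E = w $ j"
        using cramer_lemma[of j "mat 1 :: real ^ 'n ^ 'n" w]
        unfolding matrix_vector_mul_lid det_I mult_1_right E_def .
      have E: "E *v y = y + (y $ j) *\<^sub>R r" for y
      proof -
        have "(E *v y) $ i = y $ i + y $ j * r $ i" for i
        proof -
          have "(E *v y) $ i = (\<Sum>l\<in>UNIV. (if l = j then r $ i * y $ j else 0) + (if l = i then y $ i else 0))"
            by (auto simp: E_def matrix_vector_mult_def mat_def r_def axis_def algebra_simps intro!: sum.cong)
          then show ?thesis by (simp add: sum.distrib mult.commute)
        qed
        then show ?thesis by (simp add: vec_eq_iff)
      qed
      define B' where "B' = B ** E"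
      have B'in: "B' $ i \<bullet> y = B $ i \<bullet> (E *v y)" for i y
        unfolding B'_def matrix_vector_mul_component[symmetric] by (simp add: matrix_vector_mul_assoc)
      have B'int: "B' $ i \<in> integral_points" for i
      proof -
        have "B' $ i $ l \<in> \<int>" for l
        proof -
          have "B' $ i $ l = B' $ i \<bullet> axis l 1" by (simp add: inner_axis)
          also have "\<dots> = B $ i \<bullet> (axis l 1 + (axis l 1 $ j) *\<^sub>R r)" by (simp add: B'in E)
          also have "\<dots> = B $ i \<bullet> axis l 1 + axis l 1 $ j * (B $ i \<bullet> w - B $ i \<bullet> axis j 1)"
            by (simp add: r_def inner_add_right inner_diff_right)
          also have "\<dots> \<in> \<int>"
            using Bw[of i] inner_integral_points[OF less.prems(2) ax, of i] by (auto simp: axis_def)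
          finally show ?thesis .
        qed
        then show ?thesis by (simp add: integral_points_def)
      qed
      have detB': "\<bar>det B'\<bar> * real p = \<bar>det B\<bar>"
      proof -
        have "det B' * real p = det B" using wj by (simp add: B'_def det_mul detE algebra_simps)
        then show ?thesis by (metis abs_mult abs_of_nat)
      qed
      obtain n' where n': "\<bar>det B'\<bar> = real n'" using nat_det[OF B'int] by blast
      have "n' * p = n" using detB' n' less.prems(1) by (metis of_nat_eq_iff of_nat_mult)
      then have "n' < n" using n prime_gt_1_nat[OF p] by auto
      have detB'0: "det B' \<noteq> 0" using detB' less.prems(3) by auto
      (* T is the inverse of E; it turns membership in the larger lattice into integrality *)
      define T where "T y = y - (real p * y $ j) *\<^sub>R r" for y
      have Tj: "T y $ j = real p * y $ j" for y
      proof -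
        have "T y $ j = y $ j - y $ j * (real p * w $ j) + real p * y $ j"
          by (simp add: T_def r_def axis_def algebra_simps)
        then show ?thesis by (simp add: wj)
      qed
      have ET: "E *v T y = y" for y by (simp add: E Tj) (simp add: T_def)
      have Tdiff: "T (x - y) = T x - T y" for x y by (simp add: T_def algebra_simps)
      have Tint: "T y \<in> integral_points" if "y \<in> integral_points" for y
      proof -
        have T: "T y = y - y $ j *\<^sub>R (real p *\<^sub>R w) + (real p * y $ j) *\<^sub>R axis j 1"
          by (simp add: T_def r_def algebra_simps)
        have yj: "y $ j \<in> \<int>" using that by (simp add: integral_points_def)
        show ?thesis unfolding T
          by (intro integral_points_add integral_points_diff integral_points_scaleR[OF yj pw]
              integral_points_scaleR[OF _ ax] Ints_mult Ints_of_nat yj that)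
      qed
      define rel where "rel y y' \<longleftrightarrow> T y - T y' \<in> integral_points" for y y'
      have rel_refl: "rel y y" for y by (simp add: rel_def)
      have rel_sym: "rel y y' \<Longrightarrow> rel y' y" for y y'
        unfolding rel_def using integral_points_uminus[of "T y - T y'"] by simp
      have rel_trans: "rel y y' \<Longrightarrow> rel y' y'' \<Longrightarrow> rel y y''" for y y' y''
        unfolding rel_def using integral_points_add[of "T y - T y'" "T y' - T y''"] by simp
      (* h picks one representative from each class of X modulo the larger lattice *)
      define h where "h y = (SOME y'. y' \<in> X \<and> rel y y')" for y
      have h: "h y \<in> X \<and> rel y (h y)" if "y \<in> X" for y
        unfolding h_def using someI[of "\<lambda>y'. y' \<in> X \<and> rel y y'" y] that rel_refl by blast
      have h_eq: "h y = h y'" if "rel y y'" for y y'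
      proof -
        have "(\<lambda>a. a \<in> X \<and> rel y a) = (\<lambda>a. a \<in> X \<and> rel y' a)"
          using that rel_sym rel_trans by blast
        then show ?thesis by (simp add: h_def)
      qed
      have IH: "real (card (T ` h ` X)) \<le> \<bar>det B'\<bar>"
      proof (rule less.IH[OF \<open>n' < n\<close> n' B'int detB'0])
        show "finite (T ` h ` X)" using less.prems(4) by simp
        show "B' $ i \<bullet> y \<in> \<int>" if y: "y \<in> T ` h ` X" for y i
        proof -
          obtain a where "a \<in> X" "y = T (h a)" using y by blast
          then show ?thesis using h[of a] less.prems(5) by (simp add: B'in ET)
        qed
        show "y = y'" if y: "y \<in> T ` h ` X" "y' \<in> T ` h ` X" "y - y' \<in> integral_points" for y y'
        proof -
          obtain a a' where a: "a \<in> X" "a' \<in> X" "y = T (h a)" "y' = T (h a')" using y by blast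
          then have "rel (h a) (h a')" using y(3) by (simp add: rel_def)
          then have "rel a a'" using h[of a] h[of a'] a(1,2) rel_sym rel_trans by blast
          then show ?thesis using h_eq a by simp
        qed
      qed
      have "card (T ` h ` X) = card (h ` X)"
        by (rule card_image) (metis ET inj_onI)
      (* a point differs from its representative by a multiple of w modulo the integral points, and
         that multiple matters only modulo p: so a class of the larger lattice meets X in at most p points *)
      define t where "t y = \<lfloor>T y $ j - T (h y) $ j\<rfloor>" for y
      have t: "y - h y - of_int (t y) *\<^sub>R w \<in> integral_points" if "y \<in> X" for y
      proof -
        have i: "T (y - h y) \<in> integral_points" using h[OF that] by (simp add: Tdiff rel_def)
        then have tt: "T (y - h y) $ j = of_int (t y)"
          by (auto simp: t_def Tdiff integral_points_def elim: Ints_cases)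
        have "y - h y = T (y - h y) + of_int (t y) *\<^sub>R (w - axis j 1)"
          using ET[of "y - h y"] by (simp add: E tt r_def)
        then have "y - h y - of_int (t y) *\<^sub>R w = T (y - h y) - of_int (t y) *\<^sub>R axis j 1"
          by (simp add: algebra_simps)
        then show ?thesis using i ax by (auto intro!: integral_points_diff integral_points_scaleR)
      qed
      define G where "G y = (h y, t y mod int p)" for y
      have "inj_on G X"
      proof (rule inj_onI)
        fix y y' assume y: "y \<in> X" "y' \<in> X" "G y = G y'"
        then have "int p dvd t y - t y'" by (simp add: G_def mod_eq_dvd_iff)
        then obtain s where s: "t y - t y' = int p * s" by (auto elim: dvdE)
        have "y - y' = (y - h y - of_int (t y) *\<^sub>R w) - (y' - h y' - of_int (t y') *\<^sub>R w)
            + of_int (t y - t y') *\<^sub>R w"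
          using y(3) by (simp add: G_def algebra_simps)
        also have "of_int (t y - t y') *\<^sub>R w = of_int s *\<^sub>R (real p *\<^sub>R w)" by (simp add: s mult.commute)
        finally have "y - y' \<in> integral_points"
          using integral_points_add[OF integral_points_diff[OF t[OF y(1)] t[OF y(2)]]
              integral_points_scaleR[OF Ints_of_int pw, of s]] by (simp only:)
        then show "y = y'" using less.prems(6) y by blast
      qed
      moreover have "G ` X \<subseteq> h ` X \<times> {0..<int p}" using p0 by (auto simp: G_def)
      ultimately have "card X \<le> card (h ` X \<times> {0..<int p})"
        using less.prems(4) by (intro card_inj_on_le) auto
      then have "card X \<le> card (h ` X) * p" by (simp add: card_cartesian_product)
      then have "real (card X) \<le> real (card (h ` X)) * real p" by (metis of_nat_le_iff of_nat_mult)
      also have "\<dots> \<le> \<bar>det B'\<bar> * real p"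
        using IH \<open>card (T ` h ` X) = card (h ` X)\<close> by (intro mult_right_mono) auto
      finally show ?thesis by (simp only: detB')
    qed
  qed
qed

text \<open>Pigeonhole on the partial sums: there is one more of them than the list has elements, so two are
congruent modulo the integral points.\<close>

lemma integral_segment_sum:
  fixes B :: "real ^ 'n ^ 'n"
  assumes B: "\<And>i. B $ i \<in> integral_points" "det B \<noteq> 0"
    and xs: "\<And>x i. x \<in> set xs \<Longrightarrow> B $ i \<bullet> x \<in> \<int>" and len: "\<bar>det B\<bar> \<le> real (length xs)"
  obtains ys zs ws where "xs = ys @ zs @ ws" "zs \<noteq> []" "sum_list zs \<in> integral_points"
proof -
  define s where "s k = sum_list (take k xs)" for k
  have s_diff: "s l - s k = sum_list (take (l - k) (drop k xs))" if "k \<le> l" for k l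
    using that take_add[of k "l - k" xs] by (simp add: s_def)
  have Bs: "B $ i \<bullet> s k \<in> \<int>" for i k
  proof -
    have "B $ i \<bullet> sum_list ys \<in> \<int>" if "set ys \<subseteq> set xs" for ys
      using that xs by (induction ys) (auto simp: inner_add_right)
    then show ?thesis unfolding s_def by (meson set_take_subset)
  qed
  have "\<exists>k l. k < l \<and> l \<le> length xs \<and> s l - s k \<in> integral_points"
  proof (rule ccontr)
    assume n: "\<not> ?thesis"
    have nc: "k = l" if "k \<le> length xs" "l \<le> length xs" "s k - s l \<in> integral_points" for k l
      using n that integral_points_uminus[OF that(3)] by (metis linorder_neqE_nat minus_diff_eq)
    then have inj: "inj_on s {..length xs}"
      by (intro inj_onI) (metis atMost_iff diff_self integral_points_0)
    have "real (card (s ` {..length xs})) \<le> \<bar>det B\<bar>"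
    proof (rule card_noncongruent_le_det[OF B])
      show "x = y" if "x \<in> s ` {..length xs}" "y \<in> s ` {..length xs}" "x - y \<in> integral_points" for x y
        using that nc by blast
    qed (use Bs in auto)
    then show False using len by (simp add: card_image[OF inj])
  qed
  then obtain k l where kl: "k < l" "l \<le> length xs" "s l - s k \<in> integral_points" by blast
  show ?thesis
  proof
    show "xs = take k xs @ take (l - k) (drop k xs) @ drop l xs"
      using kl(1) by (metis append_take_drop_id drop_drop le_add_diff_inverse2 less_imp_le_nat)
    show "take (l - k) (drop k xs) \<noteq> []" using kl by auto
    show "sum_list (take (l - k) (drop k xs)) \<in> integral_points"
      using kl s_diff[of k l] by simp
  qed
qed

section \<open>Irreducible points of cones with minors at most two\<close>

lemma Ints_le_if_less_add_1:
  fixes a b :: real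
  assumes "a \<in> \<int>" "b \<in> \<int>" "a < b + 1"
  shows "a \<le> b"
  using assms by (auto elim!: Ints_cases)

lemma Ints_ge_1_if_pos:
  fixes a :: real
  assumes "a \<in> \<int>" "a \<ge> 0" "a \<noteq> 0"
  shows "a \<ge> 1"
  using assms by (auto elim!: Ints_cases)

text \<open>The irreducible points of a pointed cone are the elements of its Hilbert basis.\<close>

definition irreducible_point :: "(real ^ 'n) set \<Rightarrow> real ^ 'n \<Rightarrow> bool" where
  "irreducible_point D h \<longleftrightarrow> h \<in> integral_points \<and> h \<in> half_space_cone D \<and> h \<noteq> 0 \<and>
     (\<forall>x\<in>integral_points. x \<in> half_space_cone D \<longrightarrow> h - x \<in> half_space_cone D \<longrightarrow> x = 0 \<or> x = h)"

locale bimodular_rows =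
  fixes D :: "(real ^ 'n) set"
  assumes finite_rows: "finite D"
    and integral_rows: "D \<subseteq> integral_points"
    and pointed: "pointed_rows D"
    and bimodular: "\<And>B :: real ^ 'n ^ 'n. (\<And>i. B $ i \<in> D) \<Longrightarrow> \<bar>det B\<bar> \<in> {0, 1, 2}"
begin

text \<open>The tangent cone used below is described by some rows of \<open>D\<close> and the negatives of some others, and
changing signs of rows preserves the absolute values of minors.\<close>

definition signed_rows :: "(real ^ 'n) set" where
  "signed_rows = D \<union> uminus ` D"

lemma signed_rows_choice:
  assumes "\<And>i. B $ i \<in> signed_rows"
  obtains B' :: "real ^ 'n ^ 'n" where "\<And>i. B' $ i \<in> D" "\<And>i. B $ i = B' $ i \<or> B $ i = - B' $ i"
proof
  define B' :: "real ^ 'n ^ 'n" where "B' = (\<chi> i. if B $ i \<in> D then B $ i else - B $ i)"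
  show "B' $ i \<in> D" for i using assms[of i] by (auto simp: B'_def signed_rows_def)
  show "B $ i = B' $ i \<or> B $ i = - B' $ i" for i by (simp add: B'_def)
qed

lemma signed_rows_det:
  fixes B :: "real ^ 'n ^ 'n"
  assumes "\<And>i. B $ i \<in> signed_rows"
  shows "\<bar>det B\<bar> \<in> {0, 1, 2}"
  using signed_rows_choice[OF assms] abs_det_row_signs bimodular by metis

lemma signed_rows_integral: "d \<in> signed_rows \<Longrightarrow> d \<in> integral_points"
  using integral_rows integral_points_uminus by (auto simp: signed_rows_def)

lemma functional_bound_on_rays:
  fixes B :: "real ^ 'n ^ 'n"
  assumes N: "\<And>B j. (\<And>i. B $ i \<in> D) \<Longrightarrow> \<bar>det (replace_row B j c)\<bar> \<le> N"
    and B: "\<And>i. B $ i \<in> signed_rows" and u: "\<And>i. B $ i \<bullet> u = (if i = j then 1 else 0)"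
  shows "c \<bullet> u * \<bar>det B\<bar> \<le> N"
proof -
  obtain B' where B': "\<And>i. B' $ i \<in> D" "\<And>i. B $ i = B' $ i \<or> B $ i = - B' $ i"
    using signed_rows_choice[OF B] by blast
  have "c \<bullet> u * \<bar>det B\<bar> \<le> \<bar>c \<bullet> u * det B\<bar>" by (simp add: abs_mult mult_right_mono)
  also have "\<dots> = \<bar>det (replace_row B j c)\<bar>" by (simp add: det_replace_row[OF u])
  also have "\<dots> = \<bar>det (replace_row B' j c)\<bar>"
    by (rule abs_det_row_signs) (use B'(2) in \<open>auto simp: replace_row_def\<close>)
  also have "\<dots> \<le> N" using N B'(1) by blast
  finally show ?thesis .
qed

text \<open>The generator \<open>w\<close> of an extreme ray comes from a basis of determinant two, so all rows take values
in \<open>{0, 1/2, 1}\<close> on it, and its face is contained in that of \<open>h\<close>; hence both \<open>w\<close> and \<open>h - w\<close> lie in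
the cone. If \<open>w\<close> or \<open>2 w\<close> is an integral point below \<open>h\<close> in the order of the cone, it equals \<open>h\<close>.
The bound on \<open>c\<close> along rays, \<open>c \<bullet> w \<le> N / 2\<close>, settles these cases.

Otherwise some row takes the value \<open>1\<close> on both \<open>w\<close> and \<open>h\<close>, which makes \<open>w\<close> a fractional vertex of
the polytope of all \<open>x\<close> such that \<open>x\<close> and \<open>h - x\<close> lie in the cone. Let \<open>E\<close> consist of the rows
tight at \<open>w\<close>, with the signs that describe the tangent cone at \<open>w\<close>. A basis of determinant one
among them would make \<open>w\<close> integral, so all their nonzero minors are \<open>\<plusminus>2\<close>. Two things follow. On
normalised extreme rays of the tangent cone, rows of \<open>E\<close> take only the values \<open>0\<close> and \<open>1\<close>. And the
points with integral values on \<open>E\<close> form just two classes modulo the integral points: the integral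
points themselves and the class of \<open>w\<close>.

The vector \<open>y = h - w\<close> points into the tangent cone and is of the second class. Splitting off
integral extreme rays from it must stop, so its face has a generator \<open>u\<close> in the second class. Then
\<open>w + u\<close> is integral and, by rounding, still in the polytope. By irreducibility it is \<open>0\<close> or \<open>h\<close>,
and it is not \<open>0\<close> because the row that is \<open>1\<close> on both \<open>w\<close> and \<open>h\<close> vanishes on \<open>y\<close>, hence on \<open>u\<close>.
So \<open>h\<close> is the sum of two such halves, each contributing at most \<open>N / 2\<close>.\<close>

lemma irreducible_bound_via_half_ray:
  assumes irr: "irreducible_point D h"
    and B: "\<And>i. B $ i \<in> D" "\<And>i. B $ i \<bullet> w = (if i = j then 1 else 0)" "\<bar>det B\<bar> = 2"
    and w: "w \<in> half_space_cone D" and face: "\<And>d. d \<in> D \<Longrightarrow> d \<bullet> h = 0 \<Longrightarrow> d \<bullet> w = 0"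
    and N: "\<And>B j. (\<And>i. B $ i \<in> D) \<Longrightarrow> \<bar>det (replace_row B j c)\<bar> \<le> N"
  shows "c \<bullet> h \<le> N"
proof -
  have h_int: "h \<in> integral_points" and h_cone: "h \<in> half_space_cone D"
    and h_min: "\<And>x. x \<in> integral_points \<Longrightarrow> x \<in> half_space_cone D \<Longrightarrow> h - x \<in> half_space_cone D \<Longrightarrow> x = 0 \<or> x = h"
    using irr by (auto simp: irreducible_point_def)
  have D_signed: "d \<in> signed_rows" if "d \<in> D" for d using that by (simp add: signed_rows_def)
  have Bint: "B $ i \<in> integral_points" for i using B(1) integral_rows by blast
  have cw: "c \<bullet> w * 2 \<le> N"
    using functional_bound_on_rays[of c N B w j] N B D_signed by simp
  have "0 \<le> N" using N[of B j] B(1) by fastforce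
  have dh: "d \<bullet> h \<in> \<int>" "d \<bullet> h \<ge> 0" "d \<bullet> h \<noteq> 0 \<Longrightarrow> d \<bullet> h \<ge> 1" if "d \<in> D" for d
  proof -
    show 1: "d \<bullet> h \<in> \<int>" using that integral_rows h_int by (auto intro: inner_integral_points)
    show 2: "d \<bullet> h \<ge> 0" using that h_cone by (simp add: half_space_cone_def)
    show "d \<bullet> h \<ge> 1" if "d \<bullet> h \<noteq> 0" using Ints_ge_1_if_pos[OF 1 2 that] .
  qed
  have dw: "d \<bullet> w \<in> {0, 1/2, 1}" if "d \<in> D" for d
  proof -
    have "\<bar>det (replace_row B j d)\<bar> \<in> {0, 1, 2}"
      by (rule bimodular) (rule replace_row_rows[OF B(1) that])
    moreover have "0 \<le> d \<bullet> w" using w that by (simp add: half_space_cone_def)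
    ultimately show ?thesis by (auto simp: det_replace_row[OF B(2)] abs_mult B(3))
  qed
  have hw: "h - w \<in> half_space_cone D"
  proof -
    have "d \<bullet> w \<le> d \<bullet> h" if "d \<in> D" for d
      using dw[OF that] dh[OF that] face[OF that] by (cases "d \<bullet> h = 0") auto
    then show ?thesis by (simp add: half_space_cone_def inner_diff_right)
  qed
  have "w \<noteq> 0" using B(2)[of j] by auto
  have "det B *\<^sub>R w \<in> integral_points"
    by (rule det_scale_integral[OF Bint]) (simp add: B(2))
  moreover have "2 *\<^sub>R w = det B *\<^sub>R w \<or> 2 *\<^sub>R w = - (det B *\<^sub>R w)"
    using B(3) by (metis abs_if scaleR_minus_left)
  ultimately have w2: "2 *\<^sub>R w \<in> integral_points" using integral_points_uminus by metis
  show ?thesis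
  proof (cases "w \<in> integral_points")
    case True
    then have "w = h" using h_min[OF _ w hw] \<open>w \<noteq> 0\<close> by blast
    then show ?thesis using cw \<open>0 \<le> N\<close> by simp
  next
    case w_frac: False
    show ?thesis
    proof (cases "\<exists>d\<in>D. d \<bullet> w = d \<bullet> h \<and> d \<bullet> h \<noteq> 0")
      case False
      have "d \<bullet> (2 *\<^sub>R w) \<le> d \<bullet> h" if dD: "d \<in> D" for d
      proof (cases "d \<bullet> h \<ge> 2")
        case True
        then show ?thesis using dw[OF dD] by auto
      next
        case c: False
        then have "d \<bullet> h \<le> 1" using Ints_le_if_less_add_1[OF dh(1)[OF dD] Ints_1] by simp
        then consider "d \<bullet> h = 0" | "d \<bullet> h = 1" using dh(3)[OF dD] by force
        then show ?thesis
        proof cases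
          case 1
          then show ?thesis using face[OF dD] by simp
        next
          case 2
          then have "d \<bullet> w \<noteq> 1" using False dD by auto
          then show ?thesis using dw[OF dD] 2 by auto
        qed
      qed
      then have "h - 2 *\<^sub>R w \<in> half_space_cone D" by (simp add: half_space_cone_def inner_diff_right)
      moreover have "2 *\<^sub>R w \<in> half_space_cone D" using w by (simp add: half_space_cone_def)
      ultimately have "2 *\<^sub>R w = h" using h_min[OF w2] \<open>w \<noteq> 0\<close> by auto
      then show ?thesis using cw by (metis inner_scaleR_right mult.commute)
    next
      case True
      then obtain d0 where d0: "d0 \<in> D" "d0 \<bullet> w = d0 \<bullet> h" "d0 \<bullet> h \<noteq> 0" by blast
      then have d0w: "d0 \<bullet> w = 1" using dh(3)[of d0] dw[of d0] by auto
      define E where "E = {d \<in> D. d \<bullet> w = 0} \<union> uminus ` {d \<in> D. d \<bullet> w = d \<bullet> h}"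
      have E_signed: "e \<in> signed_rows" if "e \<in> E" for e using that by (auto simp: E_def signed_rows_def)
      have finE: "finite E" using finite_rows by (simp add: E_def)
      have Ew: "e \<bullet> w \<in> \<int>" if "e \<in> E" for e using that dh(1) by (auto simp: E_def)
      define B0 where "B0 = replace_row B j (- d0)"
      have B0: "B0 $ i \<in> E" for i using B d0 by (auto simp: B0_def replace_row_def E_def)
      have "det B0 \<noteq> 0" using B(3) d0w by (simp add: B0_def det_replace_row[OF B(2)])
      then have pE: "pointed_rows E"
        using det_nonzero_orthogonal[of B0] B0 by (auto simp: pointed_rows_def)
      have detE: "\<bar>det C\<bar> = 2" if C: "\<And>i. C $ i \<in> E" "det C \<noteq> 0" for C :: "real ^ 'n ^ 'n"
      proof (rule ccontr)
        assume "\<bar>det C\<bar> \<noteq> 2"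
        moreover have "\<bar>det C\<bar> \<in> {0, 1, 2}" using C(1) E_signed by (intro signed_rows_det) blast
        ultimately have one: "\<bar>det C\<bar> = 1" using C(2) by auto
        have "det C *\<^sub>R w \<in> integral_points"
          using C(1) E_signed signed_rows_integral Ew by (intro det_scale_integral) blast+
        moreover have "w = det C *\<^sub>R w \<or> w = - (det C *\<^sub>R w)"
          using one by (metis abs_if scaleR_minus_left scaleR_one)
        ultimately show False using w_frac integral_points_uminus by metis
      qed
      define y where "y = h - w"
      have y_frac: "y \<notin> integral_points"
        using w_frac integral_points_diff[OF h_int, of y] by (auto simp: y_def)
      have Ey: "e \<bullet> y \<in> \<int>" "0 \<le> e \<bullet> y" if "e \<in> E" for e
        using that dh by (auto simp: E_def y_def inner_diff_right)
      (* a minimal element of S is one from which no integral extreme ray can be subtracted *)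
      define S where "S = {x \<in> half_space_cone E. x \<notin> integral_points \<and> (\<forall>e\<in>E. e \<bullet> x \<in> \<int>) \<and>
        (\<forall>e\<in>E. e \<bullet> y = 0 \<longrightarrow> e \<bullet> x = 0)}"
      have "y \<in> S" using Ey y_frac by (simp add: S_def half_space_cone_def)
      then obtain x where x: "x \<in> S"
        and xmin: "\<And>x'. x' \<in> S \<Longrightarrow> nat \<lfloor>\<Sum>e\<in>E. e \<bullet> x\<rfloor> \<le> nat \<lfloor>\<Sum>e\<in>E. e \<bullet> x'\<rfloor>"
        using ex_has_least_nat[of "\<lambda>x. x \<in> S" y "\<lambda>x. nat \<lfloor>\<Sum>e\<in>E. e \<bullet> x\<rfloor>"] by blast
      have Ex: "e \<bullet> x \<in> \<int>" "0 \<le> e \<bullet> x" "e \<bullet> y = 0 \<Longrightarrow> e \<bullet> x = 0" if "e \<in> E" for e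
        using x that by (auto simp: S_def half_space_cone_def)
      have x_frac: "x \<notin> integral_points" using x by (simp add: S_def)
      then have "x \<noteq> 0" by auto
      obtain u C k where u: "u \<in> half_space_cone E" "\<And>e. e \<in> E \<Longrightarrow> e \<bullet> x = 0 \<Longrightarrow> e \<bullet> u = 0"
        and C: "\<And>i. C $ i \<in> E" "\<And>i. C $ i \<bullet> u = (if i = k then 1 else 0)" "det C \<noteq> 0"
        using extreme_ray_in_face[OF finE pE _ \<open>x \<noteq> 0\<close>] x by (auto simp: S_def)
      have det2: "\<bar>det C\<bar> = 2" using detE C by blast
      have Cint: "C $ i \<in> integral_points" for i using C(1) E_signed signed_rows_integral by blast
      have Eu: "e \<bullet> u \<in> {0, 1}" if "e \<in> E" for e
      proof -
        have "replace_row C k e $ i \<in> E" for i using C(1) that by (intro replace_row_rows)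
        then have "\<bar>det (replace_row C k e)\<bar> \<in> {0, 2}" using detE[of "replace_row C k e"] by fastforce
        moreover have "0 \<le> e \<bullet> u" using u(1) that by (simp add: half_space_cone_def)
        ultimately show ?thesis by (auto simp: det_replace_row[OF C(2)] abs_mult det2)
      qed
      have u_frac: "u \<notin> integral_points"
      proof
        assume ui: "u \<in> integral_points"
        have nn: "0 \<le> e \<bullet> (x - u)" if "e \<in> E" for e
          using Eu[OF that] u(2)[OF that] Ex(2)[OF that] Ints_ge_1_if_pos[OF Ex(1)[OF that] Ex(2)[OF that]]
          by (cases "e \<bullet> x = 0") (auto simp: inner_diff_right)
        have ints: "e \<bullet> (x - u) \<in> \<int>" if "e \<in> E" for e
          using Eu[OF that] Ex(1)[OF that] by (auto simp: inner_diff_right)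
        have "x - u \<notin> integral_points"
          using x_frac integral_points_add[OF _ ui, of "x - u"] by auto
        moreover have "e \<bullet> (x - u) = 0" if "e \<in> E" "e \<bullet> y = 0" for e
          using Ex(3)[OF that] u(2)[OF that(1)] by (simp add: inner_diff_right)
        ultimately have "x - u \<in> S" using nn ints by (simp add: S_def half_space_cone_def)
        then have le: "nat \<lfloor>\<Sum>e\<in>E. e \<bullet> x\<rfloor> \<le> nat \<lfloor>\<Sum>e\<in>E. e \<bullet> (x - u)\<rfloor>" by (rule xmin)
        have "1 = C $ k \<bullet> u" using C(2) by simp
        also have "\<dots> \<le> (\<Sum>e\<in>E. e \<bullet> u)"
          using member_le_sum[of "C $ k" E "\<lambda>e. e \<bullet> u"] C(1) Eu finE by fastforce
        finally have "1 + (\<Sum>e\<in>E. e \<bullet> (x - u)) \<le> (\<Sum>e\<in>E. e \<bullet> x)"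
          by (simp add: inner_diff_right sum_subtractf)
        moreover have "0 \<le> (\<Sum>e\<in>E. e \<bullet> (x - u))" using nn by (rule sum_nonneg)
        ultimately show False using le by linarith
      qed
      have "w - u \<in> integral_points"
      proof (rule ccontr)
        assume wu: "w - u \<notin> integral_points"
        then have uw: "u - w \<notin> integral_points" using integral_points_uminus[of "u - w"] by auto
        (* 0, w and u would be three classes in a lattice of index two *)
        have "real (card {0, w, u}) \<le> \<bar>det C\<bar>"
        proof (rule card_noncongruent_le_det[OF Cint C(3)])
          show "C $ i \<bullet> z \<in> \<int>" if "z \<in> {0, w, u}" for z i
            using that Ew[OF C(1)] C(2) by auto
          show "z = z'" if "z \<in> {0, w, u}" "z' \<in> {0, w, u}" "z - z' \<in> integral_points" for z z'
            using that wu uw w_frac u_frac integral_points_uminus[of "- w"] integral_points_uminus[of "- u"]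
            by auto
        qed simp
        moreover have "w \<noteq> u" "w \<noteq> 0" "u \<noteq> 0" using wu w_frac u_frac by auto
        ultimately show False by (simp add: det2)
      qed
      then have wu: "w + u \<in> integral_points"
        using integral_points_diff[OF w2, of "w - u"] by (simp add: scaleR_2)
      have range: "0 \<le> d \<bullet> (w + u) \<and> d \<bullet> (w + u) \<le> d \<bullet> h" if d: "d \<in> D" for d
      proof -
        have "\<bar>det (replace_row C k d)\<bar> \<in> {0, 1, 2}"
          using C(1) E_signed D_signed[OF d] by (intro signed_rows_det replace_row_rows) blast+
        then have du: "\<bar>d \<bullet> u\<bar> \<le> 1" by (auto simp: det_replace_row[OF C(2)] abs_mult det2)
        have int: "d \<bullet> (w + u) \<in> \<int>" using inner_integral_points wu integral_rows d by blast
        consider "d \<bullet> h = 0" | "d \<bullet> h \<noteq> 0" "d \<bullet> w = 0" | "d \<bullet> h \<noteq> 0" "d \<bullet> w = d \<bullet> h"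
          | "d \<bullet> w \<noteq> 0" "d \<bullet> w \<noteq> d \<bullet> h" by blast
        then show ?thesis
        proof cases
          case 1
          then have "d \<bullet> w = 0" using face d by blast
          then have "d \<in> E" "- d \<in> E" using 1 d by (auto simp: E_def)
          then have "d \<bullet> u = 0" using Eu[of d] Eu[of "- d"] by auto
          then show ?thesis using 1 \<open>d \<bullet> w = 0\<close> by (simp add: inner_add_right)
        next
          case 2
          then have "d \<bullet> u \<in> {0, 1}" using Eu[of d] d by (simp add: E_def)
          then show ?thesis using 2 dh(3)[OF d] by (auto simp: inner_add_right)
        next
          case 3
          then have "- d \<in> E" using d by (auto simp: E_def)
          then have "d \<bullet> u \<in> {0, - 1}" using Eu[of "- d"] by auto
          then show ?thesis using 3 dh(3)[OF d] by (auto simp: inner_add_right)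
        next
          case 4
          then have lo: "d \<bullet> w \<ge> 1/2" using dw[OF d] by auto
          have "d \<bullet> (h - w) \<ge> 0" using hw d by (simp add: half_space_cone_def)
          then have "2 * (d \<bullet> w) < 2 * (d \<bullet> h)" using 4 by (simp add: inner_diff_right)
          moreover have "2 * (d \<bullet> w) \<in> \<int>" using dw[OF d] by (auto simp: mult.commute)
          ultimately have "2 * (d \<bullet> w) \<le> 2 * (d \<bullet> h) - 1"
            using dh(1)[OF d] by (intro Ints_le_if_less_add_1) auto
          then have hi: "d \<bullet> w \<le> d \<bullet> h - 1/2" by simp
          have "0 < d \<bullet> (w + u) + 1" "d \<bullet> (w + u) < d \<bullet> h + 1"
            using lo hi du by (auto simp: inner_add_right)
          then show ?thesis using int dh(1)[OF d] Ints_le_if_less_add_1 Ints_0 by blast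
        qed
      qed
      then have "w + u \<in> half_space_cone D" "h - (w + u) \<in> half_space_cone D"
        by (auto simp: half_space_cone_def inner_diff_right)
      then have "w + u = 0 \<or> w + u = h" using h_min wu by blast
      moreover have "w + u \<noteq> 0"
      proof
        assume "w + u = 0"
        then have "u = - w" by (simp add: add_eq_0_iff)
        have "- d0 \<in> E" using d0 by (auto simp: E_def)
        moreover have "(- d0) \<bullet> y = 0" using d0 by (simp add: y_def inner_diff_right)
        ultimately have "(- d0) \<bullet> u = 0" using Ex(3) u(2) by blast
        then show False using d0w \<open>u = - w\<close> by simp
      qed
      ultimately have "h = w + u" by simp
      moreover have "c \<bullet> u * 2 \<le> N"
        using functional_bound_on_rays[of c N C u k] N C E_signed det2 by simp
      ultimately show ?thesis using cw by (simp add: inner_add_right)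
    qed
  qed
qed

text \<open>An extreme ray in the face of \<open>h\<close> is generated by some \<open>u\<close> from a basis of determinant one or two.
In the first case \<open>u\<close> is integral; either it lies below \<open>h\<close> and equals it, or some row has the value
\<open>2\<close> on \<open>u\<close> and \<open>1\<close> on \<open>h\<close>. That row turns the basis into one of determinant two for the generator
\<open>u / 2\<close> of the same ray.\<close>

lemma irreducible_bound:
  assumes irr: "irreducible_point D h"
    and N: "\<And>B j. (\<And>i. B $ i \<in> D) \<Longrightarrow> \<bar>det (replace_row B j c)\<bar> \<le> N"
  shows "c \<bullet> h \<le> N"
proof -
  have h_int: "h \<in> integral_points" and h_cone: "h \<in> half_space_cone D" and "h \<noteq> 0"
    and h_min: "\<And>x. x \<in> integral_points \<Longrightarrow> x \<in> half_space_cone D \<Longrightarrow> h - x \<in> half_space_cone D \<Longrightarrow> x = 0 \<or> x = h"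
    using irr by (auto simp: irreducible_point_def)
  obtain u B j where u: "u \<in> half_space_cone D" "\<And>d. d \<in> D \<Longrightarrow> d \<bullet> h = 0 \<Longrightarrow> d \<bullet> u = 0"
    and B: "\<And>i. B $ i \<in> D" "\<And>i. B $ i \<bullet> u = (if i = j then 1 else 0)" "det B \<noteq> 0"
    using extreme_ray_in_face[OF finite_rows pointed h_cone \<open>h \<noteq> 0\<close>] by metis
  consider "\<bar>det B\<bar> = 2" | "\<bar>det B\<bar> = 1" using bimodular[OF B(1)] B(3) by fastforce
  then show ?thesis
  proof cases
    case 1
    then show ?thesis using irreducible_bound_via_half_ray[OF irr B(1,2)] u N by blast
  next
    case 2
    have "det B *\<^sub>R u \<in> integral_points"
      using B integral_rows by (intro det_scale_integral) auto
    moreover have "u = det B *\<^sub>R u \<or> u = - (det B *\<^sub>R u)"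
      using 2 by (metis abs_if scaleR_minus_left scaleR_one)
    ultimately have ui: "u \<in> integral_points" using integral_points_uminus by metis
    show ?thesis
    proof (cases "h - u \<in> half_space_cone D")
      case True
      moreover have "u \<noteq> 0" using B(2)[of j] by auto
      ultimately have "u = h" using h_min ui u(1) by blast
      then show ?thesis
        using functional_bound_on_rays[of c N B u j] N B 2 by (simp add: signed_rows_def)
    next
      case False
      then obtain d where d: "d \<in> D" "d \<bullet> h < d \<bullet> u"
        by (auto simp: half_space_cone_def inner_diff_right)
      have "d \<bullet> h \<noteq> 0" using d u(2) by force
      moreover have "d \<bullet> h \<in> \<int>" "d \<bullet> h \<ge> 0"
        using d h_int h_cone integral_rows inner_integral_points by (auto simp: half_space_cone_def)
      ultimately have "d \<bullet> h \<ge> 1" by (intro Ints_ge_1_if_pos)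
      moreover have "\<bar>det (replace_row B j d)\<bar> \<in> {0, 1, 2}"
        by (rule bimodular) (rule replace_row_rows[OF B(1) d(1)])
      ultimately have du: "d \<bullet> u = 2"
        using d(2) by (auto simp: det_replace_row[OF B(2)] abs_mult 2)
      show ?thesis
      proof (rule irreducible_bound_via_half_ray[OF irr])
        show "replace_row B j d $ i \<in> D" for i by (rule replace_row_rows[OF B(1) d(1)])
        show "replace_row B j d $ i \<bullet> ((1/2) *\<^sub>R u) = (if i = j then 1 else 0)" for i
          using B(2)[of i] du by (auto simp: replace_row_def)
        show "\<bar>det (replace_row B j d)\<bar> = 2" by (simp add: det_replace_row[OF B(2)] du abs_mult 2)
        show "(1/2) *\<^sub>R u \<in> half_space_cone D" using u(1) by (simp add: half_space_cone_def)
        show "d' \<bullet> ((1/2) *\<^sub>R u) = 0" if "d' \<in> D" "d' \<bullet> h = 0" for d' using u(2) that by simp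
      qed (rule N)
    qed
  qed
qed

end

section \<open>A bound on points above no nonzero integral point\<close>

text \<open>The sum of all rows grows by at least one with every nonzero point of integral row values, so it
serves as a termination measure for subtracting such points.\<close>

lemma row_sum_ge_1:
  fixes D :: "(real ^ 'n) set"
  assumes fin: "finite D" and pd: "pointed_rows D"
    and z: "\<And>d. d \<in> D \<Longrightarrow> d \<bullet> z \<in> \<int>" "z \<in> half_space_cone D" "z \<noteq> 0"
  shows "(\<Sum>d\<in>D. d \<bullet> z) \<ge> 1"
proof -
  obtain d where d: "d \<in> D" "d \<bullet> z \<noteq> 0" using pd z(3) unfolding pointed_rows_def by blast
  have "d \<bullet> z \<ge> 0" using d z by (simp add: half_space_cone_def)
  then have "1 \<le> d \<bullet> z" using d(2) z(1)[OF d(1)] by (intro Ints_ge_1_if_pos)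
  also have "\<dots> \<le> (\<Sum>d\<in>D. d \<bullet> z)"
    using member_le_sum[of d D "\<lambda>d. d \<bullet> z"] d z fin by (auto simp: half_space_cone_def)
  finally show ?thesis .
qed

lemma irreducible_decomposition:
  fixes D :: "(real ^ 'n) set"
  assumes fin: "finite D" and D: "D \<subseteq> integral_points" and pd: "pointed_rows D"
    and y: "y \<in> integral_points" "y \<in> half_space_cone D"
  shows "\<exists>hs. (\<forall>h\<in>set hs. irreducible_point D h) \<and> sum_list hs = y"
  using y
proof (induction "nat \<lfloor>\<Sum>d\<in>D. d \<bullet> y\<rfloor>" arbitrary: y rule: less_induct)
  case less
  show ?case
  proof (cases "y = 0 \<or> irreducible_point D y")
    case True
    then show ?thesis
    proof
      assume "y = 0"
      then show ?thesis by (intro exI[of _ "[]"]) simp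
    next
      assume "irreducible_point D y"
      then show ?thesis by (intro exI[of _ "[y]"]) simp
    qed
  next
    case False
    then obtain x where x: "x \<in> integral_points" "x \<in> half_space_cone D" "y - x \<in> half_space_cone D"
      "x \<noteq> 0" "x \<noteq> y"
      using less.prems unfolding irreducible_point_def by blast
    have size: "(\<Sum>d\<in>D. d \<bullet> z) \<ge> 1" if z: "z \<in> integral_points" "z \<in> half_space_cone D" "z \<noteq> 0" for z
      using that D inner_integral_points by (intro row_sum_ge_1[OF fin pd]) auto
    have yx: "y - x \<in> integral_points" "y - x \<noteq> 0" using less.prems(1) x integral_points_diff by auto
    have split: "(\<Sum>d\<in>D. d \<bullet> y) = (\<Sum>d\<in>D. d \<bullet> x) + (\<Sum>d\<in>D. d \<bullet> (y - x))"
      by (simp add: inner_diff_right sum_subtractf)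
    have "nat \<lfloor>\<Sum>d\<in>D. d \<bullet> x\<rfloor> < nat \<lfloor>\<Sum>d\<in>D. d \<bullet> y\<rfloor>"
      "nat \<lfloor>\<Sum>d\<in>D. d \<bullet> (y - x)\<rfloor> < nat \<lfloor>\<Sum>d\<in>D. d \<bullet> y\<rfloor>"
      using size[OF x(1,2,4)] size[OF yx(1) x(3) yx(2)] split by linarith+
    then obtain hs hs' where "\<forall>h\<in>set hs. irreducible_point D h" "sum_list hs = x"
      "\<forall>h\<in>set hs'. irreducible_point D h" "sum_list hs' = y - x"
      using less.hyps[OF _ x(1,2)] less.hyps[OF _ yx(1) x(3)] by blast
    then show ?thesis by (intro exI[of _ "hs @ hs'"]) auto
  qed
qed

lemma half_space_cone_add: "x \<in> half_space_cone D \<Longrightarrow> y \<in> half_space_cone D \<Longrightarrow> x + y \<in> half_space_cone D"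
  by (simp add: half_space_cone_def inner_add_right)

lemma half_space_cone_sum_list: "set xs \<subseteq> half_space_cone D \<Longrightarrow> sum_list xs \<in> half_space_cone D"
  by (induction xs) (simp_all add: half_space_cone_add, simp add: half_space_cone_def)

lemma pointed_cone_sum_list_nonzero:
  assumes pd: "pointed_rows D" and xs: "set xs \<subseteq> half_space_cone D" "0 \<notin> set xs" "xs \<noteq> []"
  shows "sum_list xs \<noteq> 0"
proof
  assume z: "sum_list xs = 0"
  obtain x ys where x: "xs = x # ys" using xs(3) by (cases xs) auto
  then have s: "sum_list ys \<in> half_space_cone D" using xs(1) by (intro half_space_cone_sum_list) auto
  have "d \<bullet> x = 0" if "d \<in> D" for d
  proof -
    have "d \<bullet> x + d \<bullet> sum_list ys = 0" using z x by (simp flip: inner_add_right)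
    moreover have "d \<bullet> x \<ge> 0" "d \<bullet> sum_list ys \<ge> 0"
      using that s xs(1) x by (auto simp: half_space_cone_def)
    ultimately show ?thesis by simp
  qed
  then have "x = 0" using pd by (simp add: pointed_rows_def)
  then show False using x xs(2) by simp
qed

lemma matrix_mult_row: "(A ** C) $ i = (A $ i) v* C"
  by (simp add: vec_eq_iff matrix_matrix_mult_def vector_matrix_mult_def mult.commute)

text \<open>All minors are \<open>0\<close>, \<open>\<plusminus>g\<close> or \<open>\<plusminus>2 g\<close> for \<open>g = \<bar>det B0\<bar>\<close>. In the coordinates \<open>B0 *v x\<close> the rows
remain integral and the minors become at most two, while the integral points become a sublattice
of index \<open>g\<close>. There \<open>y\<close> is integral and splits into irreducible points. There are fewer than \<open>g\<close> of
them: otherwise some of them would add up to a nonzero point that is integral in the original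
coordinates and lies below \<open>y\<close>. Each contributes at most \<open>M / g\<close> to \<open>c \<bullet> y\<close>.\<close>

lemma minimal_point_functional_bound:
  fixes D :: "(real ^ 'n) set" and B0 :: "real ^ 'n ^ 'n"
  assumes fin: "finite D" and D: "D \<subseteq> integral_points" and pd: "pointed_rows D"
    and B0: "\<And>i. B0 $ i \<in> D" "det B0 \<noteq> 0"
    and dets: "\<And>B :: real ^ 'n ^ 'n. (\<And>i. B $ i \<in> D) \<Longrightarrow> \<bar>det B\<bar> \<in> {0, \<bar>det B0\<bar>, 2 * \<bar>det B0\<bar>}"
    and M: "\<And>B j. (\<And>i. B $ i \<in> D) \<Longrightarrow> \<bar>det (replace_row B j c)\<bar> \<le> M"
    and y: "y \<in> half_space_cone D" "\<And>d. d \<in> D \<Longrightarrow> d \<bullet> y \<in> \<int>"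
    and minimal: "\<And>x. x \<in> integral_points \<Longrightarrow> x \<in> half_space_cone D \<Longrightarrow> y - x \<in> half_space_cone D \<Longrightarrow> x = 0"
  shows "c \<bullet> y \<le> M - M / \<bar>det B0\<bar>"
proof -
  let ?g = "\<bar>det B0\<bar>"
  have g0: "?g > 0" using B0(2) by simp
  have "invertible B0" using B0(2) invertible_det_nz by blast
  then obtain C where C: "B0 ** C = mat 1" "C ** B0 = mat 1" unfolding invertible_def by blast
  have detC: "det C = 1 / det B0" using C(1) B0(2) by (metis det_I det_mul nonzero_mult_div_cancel_left)
  have BC: "B0 *v (C *v x) = x" "C *v (B0 *v x) = x" for x
    by (simp_all add: matrix_vector_mul_assoc C)
  have inner_C: "(d v* C) \<bullet> x = d \<bullet> (C *v x)" for d x by (rule dot_lmul_matrix)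
  have B0C: "B0 $ i \<bullet> (C *v x) = x $ i" for i x
    using BC(1)[of x] by (metis matrix_vector_mul_component)
  define D' where "D' = (\<lambda>d. d v* C) ` D"
  have lift: "\<exists>B. (\<forall>i. B $ i \<in> D) \<and> B' = B ** C" if "\<And>i. B' $ i \<in> D'" for B' :: "real ^ 'n ^ 'n"
  proof -
    have "\<forall>i. \<exists>d. d \<in> D \<and> B' $ i = d v* C" using that by (auto simp: D'_def)
    then obtain f where f: "\<And>i. f i \<in> D" "\<And>i. B' $ i = f i v* C" by metis
    then show ?thesis
      by (intro exI[of _ "\<chi> i. f i"]) (simp add: vec_eq_iff[of B'] matrix_mult_row)
  qed
  interpret bimodular_rows D'
  proof
    show "finite D'" using fin by (simp add: D'_def)
    show "D' \<subseteq> integral_points"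
    proof
      fix d' assume "d' \<in> D'"
      then obtain d where d: "d \<in> D" "d' = d v* C" by (auto simp: D'_def)
      have "d' $ k \<in> \<int>" for k
      proof -
        have dk: "d' $ k = d \<bullet> (C *v axis k 1)" unfolding d(2) inner_C[symmetric] by (simp add: inner_axis)
        have u: "B0 $ i \<bullet> (C *v axis k 1) = (if i = k then 1 else 0)" for i
          by (simp add: B0C axis_def)
        have "\<bar>det (replace_row B0 k d)\<bar> \<in> {0, ?g, 2 * ?g}"
          by (rule dets) (rule replace_row_rows[OF B0(1) d(1)])
        then have "\<bar>d' $ k\<bar> \<in> {0, 1, 2}"
          using g0 by (auto simp: det_replace_row[OF u] dk abs_mult)
        then have "\<bar>d' $ k\<bar> \<in> \<int>" by auto
        then show ?thesis by (cases "d' $ k \<ge> 0") auto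
      qed
      then show "d' \<in> integral_points" by (simp add: integral_points_def)
    qed
    show "pointed_rows D'"
      unfolding pointed_rows_def
    proof (intro allI impI)
      fix x assume "\<forall>d\<in>D'. d \<bullet> x = 0"
      then have "d \<bullet> (C *v x) = 0" if "d \<in> D" for d using that by (simp add: D'_def inner_C)
      then have "C *v x = 0" using pd by (simp add: pointed_rows_def)
      then show "x = 0" using BC(1)[of x] by simp
    qed
    show "\<bar>det B'\<bar> \<in> {0, 1, 2}" if B': "\<And>i. B' $ i \<in> D'" for B' :: "real ^ 'n ^ 'n"
    proof -
      obtain B where B: "\<forall>i. B $ i \<in> D" "B' = B ** C" using lift[OF B'] by blast
      have "\<bar>det B'\<bar> = \<bar>det B\<bar> / ?g" by (simp add: B(2) det_mul detC abs_mult)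
      then show ?thesis using dets[of B] B(1) g0 by auto
    qed
  qed
  have cone': "x \<in> half_space_cone D' \<longleftrightarrow> C *v x \<in> half_space_cone D" for x
    by (simp add: half_space_cone_def D'_def inner_C)
  have "B0 *v y \<in> integral_points"
    using y(2) B0(1) by (simp add: integral_points_def matrix_vector_mul_component)
  moreover have "B0 *v y \<in> half_space_cone D'" using y(1) by (simp add: cone' BC)
  ultimately obtain hs where hs: "\<And>h. h \<in> set hs \<Longrightarrow> irreducible_point D' h" "sum_list hs = B0 *v y"
    using irreducible_decomposition[OF finite_rows integral_rows pointed] by blast
  have hbound: "(c v* C) \<bullet> h \<le> M / ?g" if "h \<in> set hs" for h
  proof (rule irreducible_bound[OF hs(1)[OF that]])
    fix B' :: "real ^ 'n ^ 'n" and j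
    assume "\<And>i. B' $ i \<in> D'"
    then obtain B where B: "\<forall>i. B $ i \<in> D" "B' = B ** C" using lift by blast
    have "replace_row B' j (c v* C) = replace_row B j c ** C"
      unfolding replace_row_def B(2) by (subst vec_eq_iff) (simp add: matrix_mult_row)
    then have "\<bar>det (replace_row B' j (c v* C))\<bar> = \<bar>det (replace_row B j c)\<bar> / ?g"
      by (simp add: det_mul detC abs_mult)
    then show "\<bar>det (replace_row B' j (c v* C))\<bar> \<le> M / ?g"
      using M[of B j] B(1) g0 by (simp add: divide_right_mono)
  qed
  have linear_sum: "C *v sum_list xs = sum_list (map ((*v) C) xs)" for xs
    by (induction xs) (simp_all add: matrix_vector_right_distrib)
  have "real (length hs) < ?g"
  proof (rule ccontr)
    assume "\<not> ?thesis"
    then have len: "?g \<le> real (length (map ((*v) C) hs))" by simp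
    have "B0 $ i \<bullet> x \<in> \<int>" if "x \<in> set (map ((*v) C) hs)" for x i
      using that hs(1) by (auto simp: B0C irreducible_point_def integral_points_def)
    then obtain ys zs ws where z: "map ((*v) C) hs = ys @ zs @ ws" "zs \<noteq> []" "sum_list zs \<in> integral_points"
      using integral_segment_sum[OF _ B0(2) _ len] B0(1) D by blast
    have in_cone: "set (map ((*v) C) hs) \<subseteq> half_space_cone D"
      using hs(1) by (auto simp: irreducible_point_def cone')
    then have sub: "set ys \<subseteq> half_space_cone D" "set zs \<subseteq> half_space_cone D" "set ws \<subseteq> half_space_cone D"
      unfolding z(1) by auto
    have "0 \<notin> set (map ((*v) C) hs)"
    proof
      assume "0 \<in> set (map ((*v) C) hs)"
      then obtain h where h: "h \<in> set hs" "C *v h = 0" by auto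
      then have "h = 0" using BC(1)[of h] by simp
      then show False using hs(1)[OF h(1)] by (simp add: irreducible_point_def)
    qed
    then have "0 \<notin> set zs" unfolding z(1) by auto
    then have "sum_list zs \<noteq> 0" using pointed_cone_sum_list_nonzero[OF pd sub(2)] z(2) by blast
    moreover have "y - sum_list zs \<in> half_space_cone D"
    proof -
      have "y = sum_list (map ((*v) C) hs)" using hs(2) linear_sum[of hs] by (simp add: BC)
      then have "y - sum_list zs = sum_list ys + sum_list ws" by (simp add: z(1))
      then show ?thesis using sub by (simp add: half_space_cone_add half_space_cone_sum_list)
    qed
    ultimately show False using minimal[OF z(3)] sub(2) half_space_cone_sum_list by blast
  qed
  moreover have "?g \<in> \<int>"
  proof -
    have "B0 $ i $ j \<in> \<int>" for i j using B0(1)[of i] D by (auto simp: integral_points_def)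
    then show ?thesis by (intro Ints_abs det_in_Ints)
  qed
  ultimately have len: "real (length hs) \<le> ?g - 1"
    using Ints_le_if_less_add_1[of "real (length hs)" "?g - 1"] by simp
  have M0: "0 \<le> M" using M[of B0] B0(1) by (meson abs_ge_zero order_trans)
  have "c \<bullet> y = (c v* C) \<bullet> (B0 *v y)" by (simp add: inner_C BC)
  also have "\<dots> = (\<Sum>h\<leftarrow>hs. (c v* C) \<bullet> h)"
    unfolding hs(2)[symmetric] by (induction hs) (simp_all add: inner_add_right)
  also have "\<dots> \<le> (\<Sum>h\<leftarrow>hs. M / ?g)" using hbound by (rule sum_list_mono)
  also have "\<dots> = real (length hs) * (M / ?g)" by (simp add: sum_list_triv)
  also have "\<dots> \<le> (?g - 1) * (M / ?g)" using len M0 by (intro mult_right_mono) auto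
  also have "\<dots> = M - M / ?g" using g0 by (simp add: field_simps)
  finally show ?thesis .
qed

section \<open>Maximal minors of integral matrices\<close>

lemma det_real_of_int:
  fixes M :: "int ^ 'n ^ 'n"
  shows "det (\<chi> i j. real_of_int (M $ i $ j)) = real_of_int (det M)"
  by (simp add: det_def)

lemma Delta_facts:
  fixes M :: "int ^ 'n ^ 'k"
  assumes "CARD('n) \<le> CARD('k)"
  shows abs_minor_le_Delta: "d \<in> max_minors M \<Longrightarrow> \<bar>d\<bar> \<le> Delta M"
    and Delta_attained: "\<exists>d\<in>max_minors M. \<bar>d\<bar> = Delta M"
proof -
  have "max_minors M = (\<lambda>f. det (\<chi> i. M $ f i)) ` {f. inj f}" by (auto simp: max_minors_def)
  then have fin: "finite (abs ` max_minors M)" by simp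
  obtain f :: "'n \<Rightarrow> 'k" where "inj f"
    using assms card_le_inj[of "UNIV :: 'n set" "UNIV :: 'k set"] by auto
  then have "max_minors M \<noteq> {}" by (auto simp: max_minors_def)
  then show "\<exists>d\<in>max_minors M. \<bar>d\<bar> = Delta M"
    using Max_in[OF fin] unfolding Delta_def by fastforce
  show "\<bar>d\<bar> \<le> Delta M" if "d \<in> max_minors M"
    unfolding Delta_def using that fin by (intro Max_ge) auto
qed

lemma int_mat_rows_det:
  fixes M :: "int ^ 'n ^ 'k" and f :: "'n \<Rightarrow> 'k"
  shows "det (\<chi> i. int_mat M $ f i) = real_of_int (det (\<chi> i. M $ f i))"
proof -
  have "(\<chi> i. int_mat M $ f i) = (\<chi> i j. real_of_int ((\<chi> i. M $ f i) $ i $ j))"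
    by (simp add: vec_eq_iff int_mat_def map_matrix_def)
  then show ?thesis by (simp only: det_real_of_int)
qed

lemma det_rows_minor:
  fixes M :: "int ^ 'n ^ 'k" and f :: "'n \<Rightarrow> 'k"
  shows "det (\<chi> i. int_mat M $ f i) = 0 \<or> (\<exists>d\<in>max_minors M. det (\<chi> i. int_mat M $ f i) = real_of_int d)"
proof (cases "inj f")
  case True
  then show ?thesis by (auto simp: int_mat_rows_det max_minors_def)
next
  case False
  then obtain i j where "i \<noteq> j" "f i = f j" by (auto simp: inj_def)
  then have "det (\<chi> i. M $ f i) = 0" by (intro det_identical_rows[of i j]) (simp_all add: row_def)
  then show ?thesis by (simp add: int_mat_rows_det)
qed

lemma abs_det_rows_le_Delta:
  fixes M :: "int ^ 'n ^ 'k" and f :: "'n \<Rightarrow> 'k"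
  assumes "CARD('n) \<le> CARD('k)"
  shows "\<bar>det (\<chi> i. int_mat M $ f i)\<bar> \<le> real_of_int (Delta M)"
proof -
  have "0 \<le> Delta M" using Delta_attained[OF assms, of M] by auto
  then show ?thesis
    using det_rows_minor[of M f] abs_minor_le_Delta[OF assms, of _ M] by auto (metis of_int_abs of_int_le_iff)
qed

lemma det_replace_row_le_Delta_append_row:
  fixes A :: "int ^ 'n ^ 'm" and B :: "real ^ 'n ^ 'n"
  assumes card: "CARD('n) \<le> CARD('m)" and B: "\<And>i. B $ i \<in> range (($) (int_mat A))"
  shows "\<bar>det (replace_row B j (int_vec a))\<bar> \<le> real_of_int (Delta (append_row A a))"
    and "\<bar>det B\<bar> \<le> real_of_int (Delta (append_row A a))"
proof -
  have "\<forall>i. \<exists>k. B $ i = int_mat A $ k" using B by blast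
  then obtain f where f: "\<And>i. B $ i = int_mat A $ f i" by metis
  have card': "CARD('n) \<le> CARD('m option)" using card by simp
  have rows: "int_mat (append_row A a) $ Some k = int_mat A $ k"
    "int_mat (append_row A a) $ None = int_vec a" for k
    by (simp_all add: vec_eq_iff int_mat_def int_vec_def append_row_def map_matrix_def)
  have "replace_row B j (int_vec a) =
      (\<chi> i. int_mat (append_row A a) $ (if i = j then None else Some (f i)))"
    unfolding replace_row_def by (subst vec_eq_iff) (simp add: rows f)
  then show "\<bar>det (replace_row B j (int_vec a))\<bar> \<le> real_of_int (Delta (append_row A a))"
    by (simp only: abs_det_rows_le_Delta[OF card'])
  have "B = (\<chi> i. int_mat (append_row A a) $ Some (f i))"
    by (simp add: vec_eq_iff[of B] rows f)
  then show "\<bar>det B\<bar> \<le> real_of_int (Delta (append_row A a))"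
    using abs_det_rows_le_Delta[OF card', of "append_row A a" "\<lambda>i. Some (f i)"] by simp
qed

lemma integral_point_int_vec: "x \<in> integral_points \<longleftrightarrow> (\<exists>z. x = int_vec z)"
proof
  assume "x \<in> integral_points"
  then have "x = int_vec (\<chi> i. \<lfloor>x $ i\<rfloor>)"
    by (simp add: vec_eq_iff int_vec_def integral_points_def)
  then show "\<exists>z. x = int_vec z" by blast
qed (auto simp: integral_points_def int_vec_def)

section \<open>Integral points in a translated cone\<close>

text \<open>A cone with an interior point contains balls of arbitrarily large radius, so rounding the
coordinates of a far translate of \<open>v\<close> does not leave the translated cone.\<close>

lemma integral_translate_in_cone:
  fixes D :: "(real ^ 'n) set"
  assumes ball: "ball y0 e \<subseteq> half_space_cone D" "e > 0"
  obtains z where "z \<in> integral_points" "v - z \<in> half_space_cone D"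
proof -
  define t where "t = (real CARD('n) + 1) / e"
  have t: "t > 0" "t * e = real CARD('n) + 1" using ball(2) by (simp_all add: t_def)
  define z :: "real ^ 'n" where "z = (\<chi> i. of_int \<lfloor>(v - t *\<^sub>R y0) $ i\<rfloor>)"
  define q where "q = v - z"
  have "norm (q - t *\<^sub>R y0) \<le> (\<Sum>i\<in>UNIV. \<bar>(q - t *\<^sub>R y0) $ i\<bar>)" by (rule norm_le_l1_cart)
  also have "\<dots> \<le> (\<Sum>i\<in>(UNIV :: 'n set). 1)"
  proof (rule sum_mono)
    fix i
    have "(q - t *\<^sub>R y0) $ i = (v - t *\<^sub>R y0) $ i - of_int \<lfloor>(v - t *\<^sub>R y0) $ i\<rfloor>"
      by (simp add: q_def z_def)
    then show "\<bar>(q - t *\<^sub>R y0) $ i\<bar> \<le> 1" by linarith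
  qed
  also have "\<dots> < t * e" by (simp add: t)
  finally have "norm (q - t *\<^sub>R y0) < t * e" .
  moreover have "q - t *\<^sub>R y0 = t *\<^sub>R ((1/t) *\<^sub>R q - y0)" using t(1) by (simp add: algebra_simps)
  ultimately have "t * norm ((1/t) *\<^sub>R q - y0) < t * e" using t(1) by simp
  then have "norm ((1/t) *\<^sub>R q - y0) < e" using t(1) by simp
  then have "(1/t) *\<^sub>R q \<in> ball y0 e" by (simp add: dist_norm norm_minus_commute)
  then have "(1/t) *\<^sub>R q \<in> half_space_cone D" using ball by blast
  then have "q \<in> half_space_cone D" using t(1) by (auto simp: half_space_cone_def zero_le_divide_iff)
  moreover have "z \<in> integral_points" by (simp add: z_def integral_points_def)
  ultimately show ?thesis using that by (simp add: q_def)
qed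

lemma minimal_slack_exists:
  fixes D :: "(real ^ 'n) set"
  assumes fin: "finite D" and D: "D \<subseteq> integral_points" and pd: "pointed_rows D"
    and v: "\<And>d. d \<in> D \<Longrightarrow> d \<bullet> v \<in> \<int>"
    and z0: "z0 \<in> integral_points" "v - z0 \<in> half_space_cone D"
  obtains z where "z \<in> integral_points" "v - z \<in> half_space_cone D"
    "\<And>x. x \<in> integral_points \<Longrightarrow> x \<in> half_space_cone D \<Longrightarrow> (v - z) - x \<in> half_space_cone D \<Longrightarrow> x = 0"
proof -
  define S where "S z = (\<Sum>d\<in>D. d \<bullet> (v - z))" for z
  obtain z where z: "z \<in> integral_points" "v - z \<in> half_space_cone D"
    and zmin: "\<And>z'. z' \<in> integral_points \<Longrightarrow> v - z' \<in> half_space_cone D \<Longrightarrow> nat \<lfloor>S z\<rfloor> \<le> nat \<lfloor>S z'\<rfloor>"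
    using ex_has_least_nat[of "\<lambda>z. z \<in> integral_points \<and> v - z \<in> half_space_cone D" z0 "\<lambda>z. nat \<lfloor>S z\<rfloor>"] z0
    by blast
  show ?thesis
  proof (rule that[OF z])
    fix x assume x: "x \<in> integral_points" "x \<in> half_space_cone D" "(v - z) - x \<in> half_space_cone D"
    show "x = 0"
    proof (rule ccontr)
      assume "x \<noteq> 0"
      then have "(\<Sum>d\<in>D. d \<bullet> x) \<ge> 1"
        using x D inner_integral_points by (intro row_sum_ge_1[OF fin pd]) blast+
      moreover have "S z = S (z + x) + (\<Sum>d\<in>D. d \<bullet> x)"
        by (simp add: S_def inner_diff_right inner_add_right sum_subtractf sum.distrib algebra_simps)
      moreover have "0 \<le> S (z + x)"
        using x(3) by (auto simp: S_def half_space_cone_def diff_diff_eq intro!: sum_nonneg)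
      moreover have "nat \<lfloor>S z\<rfloor> \<le> nat \<lfloor>S (z + x)\<rfloor>"
        using x z by (intro zmin) (simp_all add: integral_points_add diff_diff_eq)
      ultimately show False by linarith
    qed
  qed
qed

lemma integral_if_coprime_minor:
  fixes B B' :: "real ^ 'n ^ 'n"
  assumes B: "\<And>i. B $ i \<in> integral_points" "\<And>i. B $ i \<bullet> v \<in> \<int>" "det B = of_int k"
    and B': "\<And>i. B' $ i \<in> integral_points" "\<And>i. B' $ i \<bullet> v \<in> \<int>" "det B' = of_int l"
    and "coprime k l"
  shows "v \<in> integral_points"
proof -
  have "of_int k *\<^sub>R v \<in> integral_points" "of_int l *\<^sub>R v \<in> integral_points"
    using det_scale_integral[OF B(1,2)] det_scale_integral[OF B'(1,2)] B(3) B'(3) by simp_all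
  moreover obtain e f where ef: "e * k + f * l = 1"
    using bezout_int[of k l] \<open>coprime k l\<close> by (metis coprime_imp_gcd_eq_1)
  ultimately have "of_int e *\<^sub>R of_int k *\<^sub>R v + of_int f *\<^sub>R of_int l *\<^sub>R v \<in> integral_points"
    using integral_points_add[OF integral_points_scaleR[of "of_int e"] integral_points_scaleR[of "of_int f"]]
    by (metis Ints_of_int)
  also have "of_int e *\<^sub>R of_int k *\<^sub>R v + of_int f *\<^sub>R of_int l *\<^sub>R v = real_of_int (e * k + f * l) *\<^sub>R v"
    by (simp add: scaleR_add_left)
  finally show ?thesis by (simp add: ef)
qed

section \<open>The width of lattice-free pyramids\<close>

theorem corollary1p8:
  fixes A :: "int ^ 'n ^ 'm" and a :: "int ^ 'n" and b :: "int ^ 'm" and b\<^sub>a \<Delta> :: int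
  assumes pyr: "pyramid_data A a b b\<^sub>a"
    and full_dim: "interior (pyramid A a b b\<^sub>a) \<noteq> {}"
    and lattice_free: "lattice_free (pyramid A a b b\<^sub>a)"
    and modular: "modular_pyramid \<Delta> A a"
    and cond: "prime (Delta A) \<or>
      (\<forall>d\<in>max_minors A. real_of_int d \<in>
         {0, real_of_int (Delta A) / 2, - (real_of_int (Delta A) / 2),
          real_of_int (Delta A), - real_of_int (Delta A)})"
  shows "width (int_vec a) (pyramid A a b b\<^sub>a) \<le> real_of_int \<Delta> - 2"
proof -
  let ?P = "pyramid A a b b\<^sub>a"
  let ?D = "range (($) (int_mat A))"
  have card: "CARD('n) \<le> CARD('m)" and rk: "rank (int_mat A) = CARD('n)"
    and dual: "- int_vec a \<in> interior (dual_cone (cone_of A))"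
    using pyr by (auto simp: pyramid_data_def)
  obtain v where v: "int_mat A *v v = int_vec b" "int_vec a \<bullet> v < real_of_int b\<^sub>a"
    using pyr by (auto simp: pyramid_data_def)
  have Delta: "\<Delta> = Delta (append_row A a)" using modular by (simp add: modular_pyramid_def)
  have fin: "finite ?D" by simp
  have D: "?D \<subseteq> integral_points" by (auto simp: integral_points_def int_mat_def map_matrix_def)
  have pd: "pointed_rows ?D"
  proof -
    have "inj ((*v) (int_mat A))" using rk by (simp add: full_rank_injective)
    then have "x = 0" if "int_mat A *v x = 0" for x
      using that by (metis injD matrix_vector_mult_0_right)
    then show ?thesis
      by (auto simp: pointed_rows_def vec_eq_iff[of "int_mat A *v _"] matrix_vector_mul_component)
  qed
  have slack: "x \<in> half_space_cone ?D \<longleftrightarrow> int_mat A *v (v - x) \<le> int_vec b" for x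
    unfolding matrix_vector_mult_diff_distrib v(1)
    by (simp add: half_space_cone_def less_eq_vec_def matrix_vector_mul_component)
  have v_int: "d \<bullet> v \<in> \<int>" if d: "d \<in> ?D" for d
  proof -
    obtain k where "d = int_mat A $ k" using d by blast
    then have "d \<bullet> v = (int_mat A *v v) $ k" by (simp add: matrix_vector_mul_component)
    then show ?thesis by (simp add: v(1) int_vec_def)
  qed
  have "v \<in> ?P" using v by (simp add: pyramid_def)
  then have v_frac: "v \<notin> integral_points"
    using lattice_free \<open>v \<in> ?P\<close> by (auto simp: lattice_free_def integral_point_int_vec)

  obtain x0 e where e: "e > 0" "ball x0 e \<subseteq> ?P" using full_dim by (meson ex_in_conv mem_interior)
  have ball: "ball (v - x0) e \<subseteq> half_space_cone ?D"
  proof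
    fix y assume "y \<in> ball (v - x0) e"
    then have "v - y \<in> ball x0 e" by (simp add: dist_norm algebra_simps norm_minus_commute)
    then show "y \<in> half_space_cone ?D" using e(2) by (auto simp: slack pyramid_def)
  qed
  obtain z0 where z0: "z0 \<in> integral_points" "v - z0 \<in> half_space_cone ?D"
    using integral_translate_in_cone[OF ball e(1)] by blast
  then have "v - z0 \<noteq> 0" using v_frac by auto
  then obtain B1 :: "real ^ 'n ^ 'n" where B1: "\<And>i. B1 $ i \<in> ?D" "det B1 \<noteq> 0"
    using extreme_ray_in_face[OF fin pd z0(2)] by metis

  have minors: "\<exists>d\<in>max_minors A. det B = real_of_int d" if "\<And>i. B $ i \<in> ?D" "det B \<noteq> 0" for B :: "real ^ 'n ^ 'n"
  proof -
    have "\<forall>i. \<exists>k. B $ i = int_mat A $ k" using that(1) by blast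
    then obtain f where "\<And>i. B $ i = int_mat A $ f i" by metis
    then have "B = (\<chi> i. int_mat A $ f i)" by (simp add: vec_eq_iff)
    then show ?thesis using det_rows_minor[of A f] that(2) by auto
  qed
  have half_or_full: "\<bar>det B\<bar> \<in> {0, real_of_int (Delta A) / 2, real_of_int (Delta A)}"
    if B: "\<And>i. B $ i \<in> ?D" for B :: "real ^ 'n ^ 'n"
  proof (cases "det B = 0")
    case False
    then obtain d where d: "d \<in> max_minors A" "det B = real_of_int d" using minors B by blast
    show ?thesis
    proof (cases "prime (Delta A)")
      case True
      obtain d' where d': "d' \<in> max_minors A" "\<bar>d'\<bar> = Delta A" using Delta_attained[OF card] by blast
      then obtain f where f: "d' = det (\<chi> i. A $ f i)" by (auto simp: max_minors_def)
      (* coprime minors would make the apex v an integral point of the pyramid *)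
      have "\<not> coprime d d'"
      proof
        assume "coprime d d'"
        moreover have "det (\<chi> i. int_mat A $ f i) = real_of_int d'" by (simp add: int_mat_rows_det f)
        ultimately have "v \<in> integral_points"
          using B D d(2) v_int
          by (intro integral_if_coprime_minor[of B v d "\<chi> i. int_mat A $ f i" d']) auto
        then show False using v_frac by simp
      qed
      then have "Delta A dvd d"
        using True d'(2) by (metis abs_dvd_iff coprime_commute coprime_abs_right_iff prime_imp_coprime)
      moreover have "\<bar>d\<bar> \<le> Delta A" "d \<noteq> 0" using abs_minor_le_Delta[OF card d(1)] d(2) False by auto
      ultimately have "\<bar>d\<bar> = Delta A" using dvd_imp_le_int[of d "Delta A"] by auto
      then show ?thesis by (simp add: d(2) flip: of_int_abs)
    next
      case False
      then have "real_of_int d \<in> {0, real_of_int (Delta A) / 2, - (real_of_int (Delta A) / 2),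
          real_of_int (Delta A), - real_of_int (Delta A)}" using cond d(1) by blast
      moreover have "0 \<le> Delta A" using abs_minor_le_Delta[OF card d(1)] by simp
      ultimately show ?thesis unfolding d(2) by auto
    qed
  qed simp
  (* B0 has the least nonzero absolute minor: Delta A / 2 if that occurs, and Delta A otherwise *)
  obtain B0 :: "real ^ 'n ^ 'n" where B0: "\<And>i. B0 $ i \<in> ?D" "det B0 \<noteq> 0"
    and dets: "\<And>B :: real ^ 'n ^ 'n. (\<And>i. B $ i \<in> ?D) \<Longrightarrow> \<bar>det B\<bar> \<in> {0, \<bar>det B0\<bar>, 2 * \<bar>det B0\<bar>}"
  proof (cases "\<exists>B :: real ^ 'n ^ 'n. (\<forall>i. B $ i \<in> ?D) \<and> det B \<noteq> 0 \<and> \<bar>det B\<bar> = real_of_int (Delta A) / 2")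
    case True
    then obtain B :: "real ^ 'n ^ 'n" where B: "\<forall>i. B $ i \<in> ?D" "det B \<noteq> 0" "\<bar>det B\<bar> = real_of_int (Delta A) / 2"
      by blast
    show ?thesis
    proof (rule that[of B])
      show "\<bar>det B'\<bar> \<in> {0, \<bar>det B\<bar>, 2 * \<bar>det B\<bar>}" if "\<And>i. B' $ i \<in> ?D" for B' :: "real ^ 'n ^ 'n"
        using half_or_full[OF that] B(3) by auto
    qed (use B in auto)
  next
    case no_half: False
    have full: "\<bar>det B\<bar> \<in> {0, real_of_int (Delta A)}" if "\<And>i. B $ i \<in> ?D" for B :: "real ^ 'n ^ 'n"
      using half_or_full[OF that] no_half that by auto
    then have "\<bar>det B1\<bar> = real_of_int (Delta A)" using B1 by fastforce
    then show ?thesis using that[OF B1] full by auto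
  qed

  obtain z where z: "z \<in> integral_points" "v - z \<in> half_space_cone ?D"
    and zmin: "\<And>x. x \<in> integral_points \<Longrightarrow> x \<in> half_space_cone ?D \<Longrightarrow> (v - z) - x \<in> half_space_cone ?D \<Longrightarrow> x = 0"
    using minimal_slack_exists[OF fin D pd v_int z0] by blast
  have Delta_replace: "\<bar>det (replace_row B j (- int_vec a))\<bar> \<le> real_of_int \<Delta>" if "\<And>i. B $ i \<in> ?D" for B j
  proof -
    have "\<bar>det (replace_row B j (- int_vec a))\<bar> = \<bar>det (replace_row B j (int_vec a))\<bar>"
      by (rule abs_det_row_signs) (simp add: replace_row_def)
    also have "\<dots> \<le> real_of_int \<Delta>"
      unfolding Delta by (rule det_replace_row_le_Delta_append_row(1)[OF card that])
    finally show ?thesis .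
  qed
  have "(- int_vec a) \<bullet> (v - z) \<le> real_of_int \<Delta> - real_of_int \<Delta> / \<bar>det B0\<bar>"
  proof (rule minimal_point_functional_bound[OF fin D pd B0 dets Delta_replace z(2) _ zmin])
    show "d \<bullet> (v - z) \<in> \<int>" if "d \<in> ?D" for d
      using v_int[OF that] inner_integral_points[OF _ z(1), of d] that D by (auto simp: inner_diff_right)
  qed
  (* Delta is at least the absolute value of det B0, so the quotient is at least 1 *)
  also have "\<dots> \<le> real_of_int \<Delta> - 1"
    using det_replace_row_le_Delta_append_row(2)[OF card B0(1), of a] B0(2) by (simp add: Delta)
  finally have az: "int_vec a \<bullet> z \<le> int_vec a \<bullet> v + real_of_int \<Delta> - 1" by (simp add: inner_diff_right)
  have "z \<notin> ?P" using lattice_free z(1) by (auto simp: lattice_free_def integral_point_int_vec)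
  then have "real_of_int b\<^sub>a < int_vec a \<bullet> z" using z(2) by (simp add: slack pyramid_def)
  moreover have "int_vec a \<in> integral_points" using integral_point_int_vec by blast
  then have "int_vec a \<bullet> z \<in> \<int>" using z(1) by (rule inner_integral_points)
  (* both sides are integers, so the strict inequality gains one; this is the second unit in Delta - 2 *)
  ultimately have "real_of_int b\<^sub>a + 1 \<le> int_vec a \<bullet> z"
    by (intro Ints_le_if_less_add_1) auto
  with az have gap: "real_of_int b\<^sub>a - int_vec a \<bullet> v \<le> real_of_int \<Delta> - 2" by simp

  have lower: "int_vec a \<bullet> v \<le> int_vec a \<bullet> x" if "x \<in> ?P" for x
  proof -
    have "0 \<le> int_mat A *v (v - x)"
      using that by (simp add: pyramid_def matrix_vector_mult_diff_distrib v(1))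
    then have "0 \<le> (v - x) \<bullet> (- int_vec a)"
      using dual interior_subset by (fastforce simp: dual_cone_def cone_of_def)
    then show ?thesis by (simp add: inner_commute[of "v - x"] inner_diff_right)
  qed
  have "(SUP x\<in>?P. int_vec a \<bullet> x) \<le> real_of_int b\<^sub>a"
    using \<open>v \<in> ?P\<close> by (intro cSUP_least) (auto simp: pyramid_def)
  moreover have "int_vec a \<bullet> v \<le> (INF x\<in>?P. int_vec a \<bullet> x)"
    using \<open>v \<in> ?P\<close> lower by (intro cINF_greatest) auto
  ultimately show ?thesis using gap by (simp add: width_def)
qed

end
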